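(* Let $\mathcal{X}$, $\mathcal{Y}$ and $\mathcal{Z}$ be three separable Hilbert spaces, and let $A\subseteq\mathcal{X}\times\mathcal{Y}$ and $B\subseteq\mathcal{X}\times\mathcal{Z}$ be two range space relations such that $\mathrm{dom}(A)$, $\mathrm{mul}(A)$, $\mathrm{ran}(B)$ and $\ker(B)$ are closed. Then there is a bounded linear operator $T\subseteq\mathcal{Z}\times\mathcal{Y}$ such that $A=TB$ if and only if the following three conditions hold: (1) $\mathrm{dom}(A)\subseteq\mathrm{dom}(B)$; (2) $\ker(B)\subseteq\ker(A)$; (3) there is a range space operator $T_{\mathrm{mul}}\subseteq\mathrm{mul}(B)\times\mathrm{mul}(A)$ such that $\mathrm{dom}(T_{\mathrm{mul}})$ is a closed subspace of $\mathrm{mul}(B)$ and $\mathrm{ran}(T_{\mathrm{mul}})=\mathrm{mul}(A)$.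
   Context: A linear relation in $\mathcal{X}\times\mathcal{Y}$ is a linear subspace $A\subseteq\mathcal{X}\times\mathcal{Y}$. One sets $\mathrm{dom}(A)=\{x:\exists y,\ (x,y)\in A\}$, $\mathrm{ran}(A)=\{y:\exists x,\ (x,y)\in A\}$, $\ker(A)=\{x:(x,0)\in A\}$, $\mathrm{mul}(A)=\{y:(0,y)\in A\}$. For linear relations $A\subseteq\mathcal{X}\times\mathcal{Y}$ and $B\subseteq\mathcal{Y}\times\mathcal{Z}$, the product is $BA=\{(x,z):\exists y\in\mathcal{Y},\ (x,y)\in A \text{ and } (y,z)\in B\}\subseteq\mathcal{X}\times\mathcal{Z}$. A linear relation $A$ is (the graph of) a linear operator, defined on $\mathrm{dom}(A)$, if and only if $\mathrm{mul}(A)=\{0\}$; linear operators are identified with their graphs. A bounded linear operator $T\subseteq\mathcal{X}\times\mathcal{Y}$ is a linear relation that is the graph of a linear operator $\mathrm{dom}(T)\to\mathcal{Y}$ which is bounded on $\mathrm{dom}(T)$ (the domain $\mathrm{dom}(T)\subseteq\mathcal{X}$ need not be all of $\mathcal{X}$). For Hilbert spaces $\mathcal{X},\mathcal{Y}$, a linear relation $A\subseteq\mathcal{X}\times\mathcal{Y}$ is a range space relation if there are a Hilbert space $\mathcal{W}$ and a bounded linear operator $F:\mathcal{W}\to\mathcal{X}\times\mathcal{Y}$ (defined on all of $\mathcal{W}$) with $\mathrm{ran}(F)=A$. A range space operator in $\mathcal{X}\times\mathcal{Y}$ is a range space relation that is the graph of a linear operator; a range space operator $S\subseteq M\times N$ with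 $M\subseteq\mathcal{X}$, $N\subseteq\mathcal{Y}$ linear subspaces is a range space operator in $\mathcal{X}\times\mathcal{Y}$ contained in $M\times N$. *)

theory Defs
  imports "HOL-Analysis.Analysis"
begin

section \<open>Scalars\<close>

text \<open>
  The field of scalars is \<open>\<real>\<close> or \<open>\<complex>\<close>. Both are instances of the following class, and up to
  isomorphism there are no others: expanding \<open>(a + 1) * kcnj (a + 1)\<close> shows that \<open>a + kcnj a\<close> is
  real, so every scalar is a root of a real quadratic polynomial, and \<open>kcnj\<close> is the usual
  conjugation.
\<close>

class real_or_complex = real_normed_field +
  fixes kcnj :: "'a \<Rightarrow> 'a"
  assumes kcnj_add: "kcnj (a + b) = kcnj a + kcnj b"
    and mult_kcnj_scaleR: "a * kcnj a = (norm a)\<^sup>2 *\<^sub>R 1"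

instantiation real :: real_or_complex
begin
definition kcnj_real :: "real \<Rightarrow> real" where "kcnj_real a = a"
instance by standard (simp_all add: kcnj_real_def power2_eq_square)
end

instantiation complex :: real_or_complex
begin
definition kcnj_complex :: "complex \<Rightarrow> complex" where "kcnj_complex a = cnj a"
instance by standard (simp_all add: kcnj_complex_def complex_mult_cnj cmod_power2 scaleR_conv_of_real)
end


section \<open>Hilbert spaces\<close>

text \<open>
  The vectors of the space form a linear subspace \<open>S\<close> of some vector space; the inner product \<open>ip\<close>
  lives on \<open>S\<close> only and its values outside \<open>S\<close> are irrelevant.
\<close>

definition ip_norm :: "('a \<Rightarrow> 'a \<Rightarrow> 'k::real_or_complex) \<Rightarrow> 'a \<Rightarrow> real"
  where "ip_norm ip x = sqrt (norm (ip x x))"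

locale inner_product_space = vector_space scale
  for scale :: "'k::real_or_complex \<Rightarrow> 'a::ab_group_add \<Rightarrow> 'a" +
  fixes S :: "'a set" and ip :: "'a \<Rightarrow> 'a \<Rightarrow> 'k"
  assumes subspace_S: "subspace S"
    and ip_add_left: "\<lbrakk>x \<in> S; y \<in> S; z \<in> S\<rbrakk> \<Longrightarrow> ip (x + y) z = ip x z + ip y z"
    and ip_scale_left: "\<lbrakk>x \<in> S; y \<in> S\<rbrakk> \<Longrightarrow> ip (scale c x) y = c * ip x y"
    and ip_commute: "\<lbrakk>x \<in> S; y \<in> S\<rbrakk> \<Longrightarrow> ip y x = kcnj (ip x y)"
    and ip_nonneg: "x \<in> S \<Longrightarrow> \<exists>r\<ge>0. ip x x = of_real r"
    and ip_definite: "\<lbrakk>x \<in> S; ip x x = 0\<rbrakk> \<Longrightarrow> x = 0"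

locale hilbert_space = inner_product_space scale S ip
  for scale :: "'k::real_or_complex \<Rightarrow> 'a::ab_group_add \<Rightarrow> 'a" and S ip +
  assumes ip_complete:
    "\<lbrakk>\<And>n. f n \<in> S; \<And>e. e > 0 \<Longrightarrow> \<exists>N. \<forall>m\<ge>N. \<forall>n\<ge>N. ip_norm ip (f m - f n) < e\<rbrakk>
      \<Longrightarrow> \<exists>l\<in>S. (\<lambda>n. ip_norm ip (f n - l)) \<longlonglongrightarrow> 0"

text \<open>
  A whole type as a Hilbert space. Norm and topology are those of the type; they are required to
  be induced by \<open>ip\<close>, and completeness is part of the sort.
\<close>

locale hilbert_type = inner_product_space scale UNIV ip
  for scale :: "'k::real_or_complex \<Rightarrow> 'a::banach \<Rightarrow> 'a" and ip +
  assumes norm_eq_ip_norm: "norm x = ip_norm ip x"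
    and scaleR_eq_scale: "r *\<^sub>R x = scale (of_real r) x"

sublocale hilbert_type \<subseteq> hilbert_space scale UNIV ip
proof
  fix f :: "nat \<Rightarrow> 'a"
  assume "\<And>e. e > 0 \<Longrightarrow> \<exists>N. \<forall>m\<ge>N. \<forall>n\<ge>N. ip_norm ip (f m - f n) < e"
  then have "Cauchy f"
    unfolding Cauchy_iff norm_eq_ip_norm by blast
  then obtain l where "f \<longlonglongrightarrow> l"
    using Cauchy_convergent convergent_def by blast
  then have "(\<lambda>n. ip_norm ip (f n - l)) \<longlonglongrightarrow> 0"
    unfolding norm_eq_ip_norm[symmetric] using LIM_zero tendsto_norm_zero by blast
  then show "\<exists>l\<in>UNIV. (\<lambda>n. ip_norm ip (f n - l)) \<longlonglongrightarrow> 0"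
    by blast
qed

lemma hilbert_type_real:
  "hilbert_type scaleR ((\<bullet>) :: 'a \<Rightarrow> 'a \<Rightarrow> real)" for dummy :: "'a::{real_inner,banach}"
proof
  show "\<exists>r\<ge>0. x \<bullet> x = of_real r" for x :: 'a
    by (rule exI[of _ "x \<bullet> x"]) simp
  show "norm x = ip_norm (\<bullet>) x" for x :: 'a
    by (simp add: ip_norm_def norm_eq_sqrt_inner)
qed (simp_all add: kcnj_real_def inner_commute algebra_simps
  module.subspace_UNIV[OF module.intro])

lemma hilbert_type_complex:
  "hilbert_type (*) (\<lambda>z w :: complex. z * cnj w)"
proof
  show "\<exists>r\<ge>0. x * cnj x = of_real r" for x :: complex
    by (rule exI[of _ "(cmod x)\<^sup>2"]) (simp only: complex_norm_square, simp)
  show "norm x = ip_norm (\<lambda>z w :: complex. z * cnj w) x" for x :: complex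
    by (simp add: ip_norm_def norm_mult)
qed (simp_all add: kcnj_complex_def scaleR_conv_of_real algebra_simps module.subspace_UNIV[OF module.intro])


section \<open>Linear relations\<close>

definition scale_prod :: "('k \<Rightarrow> 'x \<Rightarrow> 'x) \<Rightarrow> ('k \<Rightarrow> 'y \<Rightarrow> 'y) \<Rightarrow> 'k \<Rightarrow> 'x \<times> 'y \<Rightarrow> 'x \<times> 'y"
  where "scale_prod sX sY c p = (sX c (fst p), sY c (snd p))"

text \<open>
  The domain and the range of a relation are the library's \<^const>\<open>Domain\<close> and \<^const>\<open>Range\<close>. The
  product \<open>BA\<close> (first \<open>A\<close>, then \<open>B\<close>) is written \<open>A O B\<close>.
\<close>

definition linear_relation ::
    "('k::real_or_complex \<Rightarrow> 'x::ab_group_add \<Rightarrow> 'x) \<Rightarrow> ('k \<Rightarrow> 'y::ab_group_add \<Rightarrow> 'y) \<Rightarrow> ('x \<times> 'y) set \<Rightarrow> bool"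
  where "linear_relation sX sY A \<longleftrightarrow> module.subspace (scale_prod sX sY) A"

definition ker_rel :: "('x \<times> 'y::zero) set \<Rightarrow> 'x set"
  where "ker_rel A = {x. (x, 0) \<in> A}"

definition mul_rel :: "('x::zero \<times> 'y) set \<Rightarrow> 'y set"
  where "mul_rel A = {y. (0, y) \<in> A}"

definition linear_operator_graph ::
    "('k::real_or_complex \<Rightarrow> 'x::ab_group_add \<Rightarrow> 'x) \<Rightarrow> ('k \<Rightarrow> 'y::ab_group_add \<Rightarrow> 'y) \<Rightarrow> ('x \<times> 'y) set \<Rightarrow> bool"
  where "linear_operator_graph sX sY T \<longleftrightarrow> linear_relation sX sY T \<and> mul_rel T = {0}"

definition bounded_operator_graph ::
    "('k::real_or_complex \<Rightarrow> 'x::real_normed_vector \<Rightarrow> 'x) \<Rightarrow> ('k \<Rightarrow> 'y::real_normed_vector \<Rightarrow> 'y) \<Rightarrow> ('x \<times> 'y) set \<Rightarrow> bool"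
  where "bounded_operator_graph sX sY T \<longleftrightarrow>
    linear_operator_graph sX sY T \<and> (\<exists>C. \<forall>(x, y)\<in>T. norm y \<le> C * norm x)"


section \<open>Range space relations\<close>

definition bounded_linear_from ::
    "('k::real_or_complex \<Rightarrow> 'w::ab_group_add \<Rightarrow> 'w) \<Rightarrow> 'w set \<Rightarrow> ('w \<Rightarrow> 'w \<Rightarrow> 'k)
      \<Rightarrow> ('k \<Rightarrow> 'v::real_normed_vector \<Rightarrow> 'v) \<Rightarrow> ('w \<Rightarrow> 'v) \<Rightarrow> bool"
  where "bounded_linear_from sW W ip sV F \<longleftrightarrow>
    (\<forall>u\<in>W. \<forall>w\<in>W. F (u + w) = F u + F w) \<and>
    (\<forall>c. \<forall>w\<in>W. F (sW c w) = sV c (F w)) \<and>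
    (\<exists>C. \<forall>w\<in>W. norm (F w) \<le> C * ip_norm ip w)"

text \<open>
  A formula cannot quantify over types, so the Hilbert space \<open>W\<close> is taken inside a fixed vector
  space, \<open>'x \<times> 'y\<close>. Only the linear structure of \<open>W\<close> is inherited from \<open>'x \<times> 'y\<close>; the inner product
  is arbitrary. This is no restriction: \<open>range_space_relationI\<close> below admits every
  Hilbert space over every type.
\<close>

definition range_space_relation ::
    "('k::real_or_complex \<Rightarrow> 'x::real_normed_vector \<Rightarrow> 'x) \<Rightarrow> ('k \<Rightarrow> 'y::real_normed_vector \<Rightarrow> 'y) \<Rightarrow> ('x \<times> 'y) set \<Rightarrow> bool"
  where "range_space_relation sX sY A \<longleftrightarrow> linear_relation sX sY A \<and>
    (\<exists>(W :: ('x \<times> 'y) set) ip F.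
      hilbert_space (scale_prod sX sY) W ip \<and>
      bounded_linear_from (scale_prod sX sY) W ip (scale_prod sX sY) F \<and> F ` W = A)"

definition range_space_operator ::
    "('k::real_or_complex \<Rightarrow> 'x::real_normed_vector \<Rightarrow> 'x) \<Rightarrow> ('k \<Rightarrow> 'y::real_normed_vector \<Rightarrow> 'y) \<Rightarrow> ('x \<times> 'y) set \<Rightarrow> bool"
  where "range_space_operator sX sY T \<longleftrightarrow> range_space_relation sX sY T \<and> linear_operator_graph sX sY T"

section \<open>Generality of the definition of range space relations\<close>

lemma mult_kcnj: "a * kcnj a = of_real ((norm a)\<^sup>2)" for a :: "'k::real_or_complex"
  by (simp add: mult_kcnj_scaleR of_real_def)

lemma kcnj_zero [simp]: "kcnj (0::'k::real_or_complex) = 0"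
  using kcnj_add[of "0::'k" 0] by simp

lemma norm_kcnj [simp]: "norm (kcnj a) = norm (a::'k::real_or_complex)"
proof (cases "a = 0")
  case False
  have "norm a * norm (kcnj a) = (norm a)\<^sup>2"
    using arg_cong[OF mult_kcnj[of a], of norm] by (simp add: norm_mult norm_power)
  then show ?thesis using False by (simp add: power2_eq_square)
qed simp

lemma kcnj_mult: "kcnj (a * b) = kcnj a * kcnj (b::'k::real_or_complex)"
proof (cases "a * b = 0")
  case False
  have "a * b * kcnj (a * b) = (a * kcnj a) * (b * kcnj b)"
    by (simp only: mult_kcnj norm_mult power_mult_distrib of_real_mult)
  also have "\<dots> = a * b * (kcnj a * kcnj b)" by (simp add: algebra_simps)
  finally show ?thesis using False by (metis mult_left_cancel)
qed auto

lemma kcnj_kcnj [simp]: "kcnj (kcnj a) = (a::'k::real_or_complex)"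
proof (cases "a = 0")
  case False
  then have nz: "kcnj a \<noteq> 0" by (metis norm_kcnj norm_eq_zero)
  have "kcnj a * kcnj (kcnj a) = kcnj a * a"
    by (simp only: mult_kcnj norm_kcnj mult.commute[of _ a])
  then show ?thesis using nz by (metis mult_left_cancel)
qed simp

lemma kcnj_minus: "kcnj (- a) = - kcnj (a::'k::real_or_complex)"
  using kcnj_add[of a "- a"] by (simp add: eq_neg_iff_add_eq_0 add.commute)

context inner_product_space
begin

lemma S_simps [simp, intro]:
  "0 \<in> S" "x \<in> S \<Longrightarrow> y \<in> S \<Longrightarrow> x + y \<in> S" "x \<in> S \<Longrightarrow> y \<in> S \<Longrightarrow> x - y \<in> S" "x \<in> S \<Longrightarrow> scale c x \<in> S"
  using subspace_S by (auto simp: subspace_0 subspace_add subspace_diff subspace_scale)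

lemma ip_add_right: "x \<in> S \<Longrightarrow> y \<in> S \<Longrightarrow> z \<in> S \<Longrightarrow> ip z (x + y) = ip z x + ip z y"
  by (metis S_simps(2) ip_add_left ip_commute kcnj_add)

lemma ip_scale_right: "x \<in> S \<Longrightarrow> y \<in> S \<Longrightarrow> ip y (scale c x) = kcnj c * ip y x"
  by (metis S_simps(4) ip_scale_left ip_commute kcnj_mult)

lemma ip_diff_left: "x \<in> S \<Longrightarrow> y \<in> S \<Longrightarrow> z \<in> S \<Longrightarrow> ip (x - y) z = ip x z - ip y z"
  using ip_add_left[of "x - y" y z] by simp

lemma ip_diff_right: "x \<in> S \<Longrightarrow> y \<in> S \<Longrightarrow> z \<in> S \<Longrightarrow> ip z (x - y) = ip z x - ip z y"
  using ip_add_right[of "x - y" y z] by simp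

lemma ip_norm_nonneg [simp]: "ip_norm ip x \<ge> 0"
  by (simp add: ip_norm_def)

lemma ip_self: "x \<in> S \<Longrightarrow> ip x x = of_real ((ip_norm ip x)\<^sup>2)"
  using ip_nonneg[of x] by (auto simp: ip_norm_def)

lemma ip_norm_eq_0: "x \<in> S \<Longrightarrow> ip_norm ip x = 0 \<Longrightarrow> x = 0"
  using ip_self[of x] ip_definite[of x] by simp

lemma ip_norm_diff_commute: "x \<in> S \<Longrightarrow> y \<in> S \<Longrightarrow> ip_norm ip (x - y) = ip_norm ip (y - x)"
  by (simp add: ip_norm_def ip_diff_left ip_diff_right algebra_simps)

lemma parallelogram:
  assumes "x \<in> S" "y \<in> S"
  shows "(ip_norm ip (x + y))\<^sup>2 + (ip_norm ip (x - y))\<^sup>2 = 2 * (ip_norm ip x)\<^sup>2 + 2 * (ip_norm ip y)\<^sup>2"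
proof -
  have "ip (x + y) (x + y) + ip (x - y) (x - y) = 2 * ip x x + 2 * ip y y"
    using assms by (simp add: ip_add_left ip_add_right ip_diff_left ip_diff_right algebra_simps)
  then have "of_real ((ip_norm ip (x + y))\<^sup>2 + (ip_norm ip (x - y))\<^sup>2) =
      (of_real (2 * (ip_norm ip x)\<^sup>2 + 2 * (ip_norm ip y)\<^sup>2) :: 'k)"
    using assms by (simp add: ip_self)
  then show ?thesis by (simp only: of_real_eq_iff)
qed

lemma pythagoras:
  assumes "x \<in> S" "y \<in> S" "ip x y = 0"
  shows "(ip_norm ip (x + y))\<^sup>2 = (ip_norm ip x)\<^sup>2 + (ip_norm ip y)\<^sup>2"
proof -
  have "ip y x = 0" using assms ip_commute[of x y] by simp
  then have "ip (x + y) (x + y) = ip x x + ip y y"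
    using assms by (simp add: ip_add_left ip_add_right)
  then have "of_real ((ip_norm ip (x + y))\<^sup>2) = (of_real ((ip_norm ip x)\<^sup>2 + (ip_norm ip y)\<^sup>2) :: 'k)"
    using assms by (simp add: ip_self)
  then show ?thesis by (simp only: of_real_eq_iff)
qed

text \<open>The best multiple of \<open>y\<close> to subtract from \<open>x\<close>.\<close>

lemma ip_norm_sub_proj:
  assumes "x \<in> S" "y \<in> S" "y \<noteq> 0"
  shows "(ip_norm ip (x - scale (ip x y / ip y y) y))\<^sup>2 = (ip_norm ip x)\<^sup>2 - (norm (ip x y))\<^sup>2 / (ip_norm ip y)\<^sup>2"
proof -
  let ?c = "ip x y / ip y y" let ?u = "x - scale ?c y"
  have yy: "ip y y \<noteq> 0" using assms ip_definite by blast
  have "ip ?u (scale ?c y) = 0"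
    using assms yy by (simp add: ip_diff_left ip_scale_left ip_scale_right)
  then have "(ip_norm ip (?u + scale ?c y))\<^sup>2 = (ip_norm ip ?u)\<^sup>2 + (ip_norm ip (scale ?c y))\<^sup>2"
    using assms by (intro pythagoras) auto
  moreover have "(ip_norm ip (scale ?c y))\<^sup>2 = (norm (ip x y))\<^sup>2 / (ip_norm ip y)\<^sup>2"
  proof -
    have "(ip_norm ip (scale ?c y))\<^sup>2 = norm ?c * norm ?c * norm (ip y y)"
      using assms by (simp only: ip_norm_def ip_scale_left ip_scale_right S_simps norm_mult norm_kcnj
        real_sqrt_pow2 norm_ge_zero mult_nonneg_nonneg mult.assoc)
    also have "\<dots> = (norm (ip x y))\<^sup>2 / norm (ip y y)"
      using yy by (simp add: norm_divide power2_eq_square)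
    finally show ?thesis by (simp add: ip_norm_def)
  qed
  ultimately show ?thesis by simp
qed

lemma cauchy_schwarz:
  assumes "x \<in> S" "y \<in> S"
  shows "norm (ip x y) \<le> ip_norm ip x * ip_norm ip y"
proof (cases "y = 0")
  case True
  have "ip x 0 = 0" using ip_diff_right[of x x x] assms by simp
  then show ?thesis using True by simp
next
  case False
  then have pos: "ip_norm ip y > 0"
    using assms ip_norm_eq_0 ip_norm_nonneg[of y] by (metis order_le_less)
  have "0 \<le> (ip_norm ip x)\<^sup>2 - (norm (ip x y))\<^sup>2 / (ip_norm ip y)\<^sup>2"
    using ip_norm_sub_proj[OF assms False] by (metis zero_le_power2)
  then have "(norm (ip x y))\<^sup>2 \<le> (ip_norm ip x * ip_norm ip y)\<^sup>2"
    using pos by (simp add: field_simps power_mult_distrib)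
  then show ?thesis by (rule power2_le_imp_le) simp
qed

lemma ip_norm_triangle:
  assumes "x \<in> S" "y \<in> S"
  shows "ip_norm ip (x + y) \<le> ip_norm ip x + ip_norm ip y"
proof -
  have "norm (ip (x + y) (x + y)) \<le> norm (ip x x) + norm (ip x y) + norm (ip y x) + norm (ip y y)"
    using assms norm_triangle_ineq[of "ip x x + ip x y + ip y x" "ip y y"]
      norm_triangle_ineq[of "ip x x + ip x y" "ip y x"] norm_triangle_ineq[of "ip x x" "ip x y"]
    by (simp add: ip_add_left ip_add_right algebra_simps)
  also have "\<dots> \<le> (ip_norm ip x)\<^sup>2 + ip_norm ip x * ip_norm ip y + ip_norm ip y * ip_norm ip x + (ip_norm ip y)\<^sup>2"
    using cauchy_schwarz[OF assms] cauchy_schwarz[OF assms(2,1)]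
    by (simp add: ip_self[OF assms(1)] ip_self[OF assms(2)] norm_power mult.commute[of "ip_norm ip y"])
  finally have "(ip_norm ip (x + y))\<^sup>2 \<le> (ip_norm ip x + ip_norm ip y)\<^sup>2"
    by (simp add: ip_norm_def[of ip "x + y"] power2_sum algebra_simps)
  then show ?thesis by (rule power2_le_imp_le) simp
qed

lemma ip_norm_scale: "x \<in> S \<Longrightarrow> ip_norm ip (scale c x) = norm c * ip_norm ip x"
  by (simp add: ip_norm_def ip_scale_left ip_scale_right norm_mult real_sqrt_mult flip: mult.assoc)

end

context hilbert_space
begin

lemma orthogonal_decomposition:
  assumes N: "subspace N" "N \<subseteq> S"
    and N_closed: "\<And>f l. \<lbrakk>\<And>n. f n \<in> N; l \<in> S; (\<lambda>n. ip_norm ip (f n - l)) \<longlonglongrightarrow> 0\<rbrakk> \<Longrightarrow> l \<in> N"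
    and w: "w \<in> S"
  shows "\<exists>l\<in>N. \<forall>n\<in>N. ip (w - l) n = 0"
proof -
  define d where "d = Inf ((\<lambda>n. ip_norm ip (w - n)) ` N)"
  have ne: "N \<noteq> {}" using N(1) subspace_0 by blast
  have bdd: "bdd_below ((\<lambda>n. ip_norm ip (w - n)) ` N)" by (rule bdd_belowI2[of _ 0]) simp
  have d_le: "d \<le> ip_norm ip (w - n)" if "n \<in> N" for n
    unfolding d_def using bdd that by (rule cINF_lower)
  have d0: "d \<ge> 0" unfolding d_def using ne by (intro cINF_greatest) auto
  have "\<exists>n\<in>N. ip_norm ip (w - n) < d + 1 / Suc k" for k
    using cINF_less_iff[OF ne bdd, of "d + 1 / Suc k"] by (simp add: d_def)
  then obtain f where f: "\<And>k. f k \<in> N" "\<And>k. ip_norm ip (w - f k) < d + 1 / Suc k" by metis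
  have fS: "f k \<in> S" for k using f(1) N(2) by blast
  have half: "(ip_norm ip (f i - f j))\<^sup>2 \<le> 2 * (d + 1 / Suc i)\<^sup>2 + 2 * (d + 1 / Suc j)\<^sup>2 - 4 * d\<^sup>2" for i j
  proof -
    let ?m = "scale (of_real (1/2)) (f i + f j)"
    have m: "?m \<in> N" using f(1) N(1) by (simp add: subspace_add subspace_scale)
    have mS: "?m \<in> S" using m N(2) by blast
    have two: "scale 2 ?m = f i + f j"
      by (simp del: scale_right_distrib)
    have "(w - f i) + (w - f j) = scale 2 (w - ?m)"
      unfolding scale_right_diff_distrib two
      by (metis add_diff_add one_add_one scale_left_distrib scale_one)
    then have "ip_norm ip ((w - f i) + (w - f j)) = 2 * ip_norm ip (w - ?m)"
      using w mS by (simp add: ip_norm_scale del: of_real_divide)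
    moreover have "d\<^sup>2 \<le> (ip_norm ip (w - ?m))\<^sup>2" using d_le[OF m] d0 by (rule power_mono)
    ultimately have "4 * d\<^sup>2 \<le> (ip_norm ip ((w - f i) + (w - f j)))\<^sup>2"
      by (simp add: power_mult_distrib)
    moreover have "(ip_norm ip (w - f i))\<^sup>2 \<le> (d + 1 / Suc i)\<^sup>2" "(ip_norm ip (w - f j))\<^sup>2 \<le> (d + 1 / Suc j)\<^sup>2"
      using f(2)[of i] f(2)[of j] by (intro power_mono; simp)+
    moreover have "(w - f i) - (w - f j) = f j - f i" by simp
    ultimately show ?thesis
      using parallelogram[of "w - f i" "w - f j"] w fS ip_norm_diff_commute[of "f i" "f j"]
      by (simp add: algebra_simps)
  qed
  have "\<exists>l\<in>S. (\<lambda>n. ip_norm ip (f n - l)) \<longlonglongrightarrow> 0"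
  proof (rule ip_complete[OF fS])
    fix e :: real assume e: "e > 0"
    have "(\<lambda>k. 2 * (d + 1 / Suc k)\<^sup>2 - 2 * d\<^sup>2) \<longlonglongrightarrow> 2 * (d + 0)\<^sup>2 - 2 * d\<^sup>2"
      by (intro tendsto_intros LIMSEQ_Suc lim_1_over_n)
    then have "\<forall>\<^sub>F k in sequentially. 2 * (d + 1 / Suc k)\<^sup>2 - 2 * d\<^sup>2 < e\<^sup>2 / 2"
      using e by (intro order_tendstoD(2)) auto
    then obtain K where K: "\<And>k. k \<ge> K \<Longrightarrow> 2 * (d + 1 / Suc k)\<^sup>2 - 2 * d\<^sup>2 < e\<^sup>2 / 2"
      by (auto simp: eventually_sequentially)
    have "ip_norm ip (f i - f j) < e" if "i \<ge> K" "j \<ge> K" for i j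
    proof -
      have "(ip_norm ip (f i - f j))\<^sup>2 < e\<^sup>2" using half[of i j] K[OF that(1)] K[OF that(2)] by linarith
      then show ?thesis using e by (simp add: power_less_imp_less_base)
    qed
    then show "\<exists>K. \<forall>i\<ge>K. \<forall>j\<ge>K. ip_norm ip (f i - f j) < e" by blast
  qed
  then obtain l where lS: "l \<in> S" and l: "(\<lambda>n. ip_norm ip (f n - l)) \<longlonglongrightarrow> 0" by blast
  have lN: "l \<in> N" using N_closed f(1) lS l by blast
  have "ip_norm ip (w - l) \<le> d"
  proof (rule LIMSEQ_le_const)
    have "(\<lambda>k. (d + 1 / Suc k) + ip_norm ip (f k - l)) \<longlonglongrightarrow> (d + 0) + 0"
      by (intro tendsto_intros LIMSEQ_Suc lim_1_over_n l)
    then show "(\<lambda>k. (d + 1 / Suc k) + ip_norm ip (f k - l)) \<longlonglongrightarrow> d" by simp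
    have "ip_norm ip (w - l) \<le> (d + 1 / Suc k) + ip_norm ip (f k - l)" for k
      using ip_norm_triangle[of "w - f k" "f k - l"] f(2)[of k] w fS lS by simp
    then show "\<exists>K. \<forall>k\<ge>K. ip_norm ip (w - l) \<le> (d + 1 / Suc k) + ip_norm ip (f k - l)" by blast
  qed
  then have dl: "ip_norm ip (w - l) = d" using d_le[OF lN] by simp
  have "ip (w - l) n = 0" if n: "n \<in> N" for n
  proof (cases "n = 0")
    case True
    then show ?thesis using ip_diff_right[of "w - l" "w - l" "w - l"] w lS by simp
  next
    case False
    let ?c = "ip (w - l) n / ip n n"
    have nS: "n \<in> S" using n N(2) by blast
    have "l + scale ?c n \<in> N" using lN n N(1) by (simp add: subspace_add subspace_scale)
    then have "d \<le> ip_norm ip (w - l - scale ?c n)" using d_le by (metis diff_diff_eq)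
    then have "d\<^sup>2 \<le> (ip_norm ip (w - l - scale ?c n))\<^sup>2" using d0 by (rule power_mono)
    then have "(norm (ip (w - l) n))\<^sup>2 / (ip_norm ip n)\<^sup>2 \<le> 0"
      using ip_norm_sub_proj[of "w - l" n] w lS nS False dl by simp
    moreover have "ip_norm ip n \<noteq> 0" using ip_norm_eq_0 nS False by blast
    ultimately show ?thesis by (simp add: divide_le_0_iff)
  qed
  then show ?thesis using lN by blast
qed

end

lemma vector_space_scale_prod:
  assumes "vector_space sX" "vector_space sY"
  shows "vector_space (scale_prod sX sY)"
proof -
  interpret X: vector_space sX by fact
  interpret Y: vector_space sY by fact
  show ?thesis
    by unfold_locales (auto simp: scale_prod_def X.scale_right_distrib X.scale_left_distrib
      Y.scale_right_distrib Y.scale_left_distrib)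
qed

theorem range_space_relationI:
  fixes sX :: "'k::real_or_complex \<Rightarrow> 'x::real_normed_vector \<Rightarrow> 'x"
    and sY :: "'k \<Rightarrow> 'y::real_normed_vector \<Rightarrow> 'y"
    and sW :: "'k \<Rightarrow> 'w::ab_group_add \<Rightarrow> 'w"
  assumes vs: "vector_space sX" "vector_space sY"
    and W: "hilbert_space sW W ip"
    and F: "bounded_linear_from sW W ip (scale_prod sX sY) F" "F ` W = A"
  shows "range_space_relation sX sY A"
proof -
  interpret V: vector_space "scale_prod sX sY" using vs by (rule vector_space_scale_prod)
  interpret W: hilbert_space sW W ip by fact
  note V.scale_right_distrib [simp del] V.scale_left_distrib [simp del]
    W.scale_right_distrib [simp del] W.scale_left_distrib [simp del]
  have F_add: "F (u + w) = F u + F w" if "u \<in> W" "w \<in> W" for u w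
    using F(1) that by (simp add: bounded_linear_from_def)
  have F_scale: "F (sW c w) = scale_prod sX sY c (F w)" if "w \<in> W" for c w
    using F(1) that by (simp add: bounded_linear_from_def)
  have F_diff: "F (u - w) = F u - F w" if "u \<in> W" "w \<in> W" for u w
    using F_add[of "u - w" w] that by (simp add: algebra_simps)
  have F_0: "F 0 = 0" using F_diff[of 0 0] by simp
  obtain C0 where C0: "\<And>w. w \<in> W \<Longrightarrow> norm (F w) \<le> C0 * ip_norm ip w"
    using F(1) unfolding bounded_linear_from_def by blast
  define N where "N = {w \<in> W. F w = 0}"
  have N_sub: "W.subspace N"
    by (rule W.subspaceI) (auto simp: N_def F_0 F_add F_scale)
  have N_closed: "l \<in> N"
    if f: "\<And>n. f n \<in> N" and l: "l \<in> W" and lim: "(\<lambda>n. ip_norm ip (f n - l)) \<longlonglongrightarrow> 0" for f l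
  proof -
    have "norm (F l) \<le> C0 * ip_norm ip (f n - l)" for n
      using C0[of "f n - l"] f[of n] l by (simp add: N_def F_diff)
    then have "norm (F l) \<le> C0 * 0"
      by (intro LIMSEQ_le_const[OF tendsto_mult_left[OF lim, of C0]]) blast
    then show ?thesis using l by (simp add: N_def)
  qed
  define P where "P = {w \<in> W. \<forall>n\<in>N. ip w n = 0}"
  have P_add: "u + w \<in> P" if "u \<in> P" "w \<in> P" for u w
    using that by (auto simp: P_def N_def W.ip_add_left)
  have P_scale: "sW c w \<in> P" if "w \<in> P" for c w
    using that by (auto simp: P_def N_def W.ip_scale_left)
  have P_inj: "u = w" if "u \<in> P" "w \<in> P" "F u = F w" for u w
  proof -
    have "u - w \<in> N" using that by (auto simp: P_def N_def F_diff)
    then have "ip (u - w) (u - w) = 0"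
      using that W.ip_diff_left[of u w "u - w"] by (simp add: P_def)
    then have "u - w = 0" using that by (intro W.ip_definite) (auto simp: P_def)
    then show ?thesis by simp
  qed
  have lift: "\<exists>u\<in>P. F u = F w \<and> ip_norm ip u \<le> ip_norm ip w" if w: "w \<in> W" for w
  proof -
    have "\<exists>l\<in>N. \<forall>n\<in>N. ip (w - l) n = 0"
    proof (rule W.orthogonal_decomposition[OF N_sub _ _ w])
      show "N \<subseteq> W" by (auto simp: N_def)
    qed (rule N_closed)
    then obtain l where l: "l \<in> N" "\<And>n. n \<in> N \<Longrightarrow> ip (w - l) n = 0" by blast
    then have lW: "l \<in> W" "F l = 0" by (auto simp: N_def)
    have "(ip_norm ip (w - l + l))\<^sup>2 = (ip_norm ip (w - l))\<^sup>2 + (ip_norm ip l)\<^sup>2"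
      using W.pythagoras[of "w - l" l] w lW l by blast
    then have "(ip_norm ip (w - l))\<^sup>2 \<le> (ip_norm ip w)\<^sup>2" by simp
    then have "ip_norm ip (w - l) \<le> ip_norm ip w" by (rule power2_le_imp_le) simp
    moreover have "w - l \<in> P" using w lW l by (simp add: P_def)
    ultimately show ?thesis using w lW by (intro bexI[of _ "w - l"]) (simp_all add: F_diff)
  qed
  define g where "g a = (THE u. u \<in> P \<and> F u = a)" for a
  have g_eq: "g (F u) = u" if "u \<in> P" for u
    unfolding g_def using that P_inj by blast
  have g: "g a \<in> P" "F (g a) = a" if "a \<in> A" for a
    using that lift g_eq unfolding F(2)[symmetric] by (metis (no_types, lifting) imageE)+
  have gW: "g a \<in> W" if "a \<in> A" for a using g(1)[OF that] by (simp add: P_def)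
  have A_sub: "V.subspace A"
  proof (rule V.subspaceI)
    show "0 \<in> A" using F(2) F_0 W.S_simps(1) by (metis imageI)
    show "a + b \<in> A" if "a \<in> A" "b \<in> A" for a b
      using that unfolding F(2)[symmetric] by (auto simp flip: F_add)
    show "scale_prod sX sY c a \<in> A" if "a \<in> A" for c a
      using that unfolding F(2)[symmetric] by (auto simp flip: F_scale)
  qed
  have g_add: "g (a + b) = g a + g b" if "a \<in> A" "b \<in> A" for a b
    using g_eq[OF P_add[OF g(1)[OF that(1)] g(1)[OF that(2)]]] that by (simp add: F_add gW g(2))
  have g_scale: "g (scale_prod sX sY c a) = sW c (g a)" if "a \<in> A" for c a
    using g_eq[OF P_scale[OF g(1)[OF that]]] that by (simp add: F_scale gW g(2))
  have A_diff: "a - b \<in> A" if "a \<in> A" "b \<in> A" for a b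
    using A_sub that by (rule V.subspace_diff)
  have g_diff: "g (a - b) = g a - g b" if "a \<in> A" "b \<in> A" for a b
    using g_add[OF A_diff[OF that] that(2)] by simp
  define ipA where "ipA a b = ip (g a) (g b)" for a b
  have nA: "ip_norm ipA a = ip_norm ip (g a)" for a by (simp add: ip_norm_def ipA_def)
  have "hilbert_space (scale_prod sX sY) A ipA"
  proof (unfold_locales, rule A_sub)
    show "ipA (a + b) c = ipA a c + ipA b c" if "a \<in> A" "b \<in> A" "c \<in> A" for a b c
      using that by (simp add: ipA_def g_add gW W.ip_add_left)
    show "ipA (scale_prod sX sY c a) b = c * ipA a b" if "a \<in> A" "b \<in> A" for a b c
      using that by (simp add: ipA_def g_scale gW W.ip_scale_left)
    show "ipA b a = kcnj (ipA a b)" if "a \<in> A" "b \<in> A" for a b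
      using that W.ip_commute[of "g a" "g b"] by (simp add: ipA_def gW)
    show "\<exists>r\<ge>0. ipA a a = of_real r" if "a \<in> A" for a
      using that W.ip_nonneg[of "g a"] by (simp add: ipA_def gW)
    show "a = 0" if "a \<in> A" "ipA a a = 0" for a
      using that W.ip_definite[of "g a"] g(2)[of a] F_0 by (simp add: ipA_def gW)
  next
    fix f :: "nat \<Rightarrow> 'x \<times> 'y"
    assume f: "\<And>n. f n \<in> A"
      and Cau: "\<And>e. e > 0 \<Longrightarrow> \<exists>N. \<forall>m\<ge>N. \<forall>n\<ge>N. ip_norm ipA (f m - f n) < e"
    have "\<exists>l\<in>W. (\<lambda>n. ip_norm ip (g (f n) - l)) \<longlonglongrightarrow> 0"
      using Cau f by (intro W.ip_complete) (simp_all add: gW nA g_diff)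
    then obtain l where l: "l \<in> W" and lim: "(\<lambda>n. ip_norm ip (g (f n) - l)) \<longlonglongrightarrow> 0" by blast
    have Fl: "F l \<in> A" using l F(2) by blast
    have "ip_norm ipA (f n - F l) \<le> ip_norm ip (g (f n) - l)" for n
    proof -
      obtain u where u: "u \<in> P" "F u = F (g (f n) - l)" "ip_norm ip u \<le> ip_norm ip (g (f n) - l)"
        using lift[of "g (f n) - l"] gW[OF f] l by auto
      moreover have "F (g (f n) - l) = f n - F l" using gW[OF f] l g(2)[OF f] by (simp add: F_diff)
      ultimately show ?thesis using g_eq[of u] by (simp add: nA)
    qed
    then have "(\<lambda>n. ip_norm ipA (f n - F l)) \<longlonglongrightarrow> 0"
      by (intro tendsto_sandwich[OF _ _ tendsto_const lim]) (simp_all add: nA)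
    then show "\<exists>l\<in>A. (\<lambda>n. ip_norm ipA (f n - l)) \<longlonglongrightarrow> 0" using Fl by blast
  qed
  moreover have "bounded_linear_from (scale_prod sX sY) A ipA (scale_prod sX sY) id"
    unfolding bounded_linear_from_def using C0 g(2) gW nA by (metis id_apply)
  moreover have "id ` A = A" by simp
  ultimately show ?thesis
    unfolding range_space_relation_def linear_relation_def using A_sub by blast
qed

end

theory Submission
  imports Defs
begin

text \<open>
  By the open mapping theorem, a range space relation with closed domain \<open>D\<close> contains for every
  \<open>x \<in> D\<close> some pair \<open>(x, y)\<close> with \<open>\<parallel>y\<parallel> \<le> C \<parallel>x\<parallel>\<close>. Applied
  to \<open>B\<inverse>\<close>, this shows together with the closedness of \<open>ker B\<close> that \<open>mul B\<close> is closed.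

  If \<open>A = TB\<close>, then \<open>T\<close> maps \<open>dom T \<inter> mul B\<close> onto \<open>mul A\<close>, and the closure of this restriction is
  still a bounded operator, now with closed domain; it serves as \<open>T_mul\<close>. Conversely, the pairs
  \<open>(z, y) \<in> AB\<inverse>\<close> with \<open>z \<bottom> mul B\<close> and \<open>y \<bottom> mul A\<close> form a bounded operator, because of the bounds
  for \<open>A\<close> and \<open>B\<inverse>\<close> and since \<open>ker B \<subseteq> ker A\<close>. Its sum with \<open>T_mul\<close>, whose domain is orthogonal
  to the first one, is the required \<open>T\<close>.
\<close>

section \<open>The open mapping theorem\<close>

text \<open>A closed subset of a complete metric space is completely metrizable, so Baire's theorem
  applies in the subspace topology of \<open>D\<close>. If every \<open>E n\<close> had empty
  interior relative to \<open>D\<close>, so would their union, which is the nonempty set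
  \<open>D\<close> itself.\<close>

lemma Baire_closed_cover:
  fixes D :: "'v::complete_space set"
  assumes D: "closed D" "D \<noteq> {}"
    and E: "\<And>n::nat. closed (E n)" "D = (\<Union>n. E n)"
  obtains n x r where "x \<in> D" "r > 0" "ball x r \<inter> D \<subseteq> E n"
proof -
  have "\<exists>n. top_of_set D interior_of E n \<noteq> {}"
  proof (rule ccontr)
    assume "\<not> ?thesis"
    then have "top_of_set D interior_of \<Union>(range E) = {}"
      using D E by (intro Baire_category_alt disjI1)
        (auto intro!: completely_metrizable_space_closedin completely_metrizable_space_euclidean closed_subset)
    then show False
      using D E(2) interior_of_topspace[of "top_of_set D"] by simp
  qed
  then obtain n x where "x \<in> top_of_set D interior_of E n" by blast
  then obtain T where T: "openin (top_of_set D) T" "x \<in> T" "T \<subseteq> E n"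
    by (auto simp: interior_of_def)
  then obtain r where "r > 0" "ball x r \<inter> D \<subseteq> T"
    unfolding openin_contains_ball by blast
  moreover have "x \<in> D" using T(1,2) openin_imp_subset by blast
  ultimately show ?thesis using T(3) that by blast
qed

section \<open>Bounded linear maps on an inner product space\<close>

lemma bounded_linear_fromD:
  assumes "bounded_linear_from sW W ip sV F"
  shows "u \<in> W \<Longrightarrow> w \<in> W \<Longrightarrow> F (u + w) = F u + F w"
    and "w \<in> W \<Longrightarrow> F (sW c w) = sV c (F w)"
    and "\<exists>C. \<forall>w\<in>W. norm (F w) \<le> C * ip_norm ip w"
  using assms unfolding bounded_linear_from_def by blast+

lemma (in inner_product_space) bounded_linear_from_diff:
  assumes "bounded_linear_from scale S ip sV G" "u \<in> S" "w \<in> S"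
  shows "G (u - w) = G u - G w"
  using bounded_linear_fromD(1)[OF assms(1), of "u - w" w] assms by (simp add: algebra_simps)

lemma (in inner_product_space) ip_norm_triangle_diff:
  assumes "u \<in> S" "w \<in> S"
  shows "ip_norm ip (u - w) \<le> ip_norm ip u + ip_norm ip w"
  using ip_norm_triangle[of u "0 - w"] ip_norm_diff_commute[of 0 w] assms S_simps(3)[of 0 w] by simp

lemma (in inner_product_space) bounded_linear_from_range:
  assumes G: "bounded_linear_from scale S ip sV G"
  shows "a \<in> G ` S \<Longrightarrow> b \<in> G ` S \<Longrightarrow> a + b \<in> G ` S"
    and "a \<in> G ` S \<Longrightarrow> b \<in> G ` S \<Longrightarrow> a - b \<in> G ` S"
    and "a \<in> G ` S \<Longrightarrow> sV c a \<in> G ` S"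
proof -
  show "a + b \<in> G ` S" if "a \<in> G ` S" "b \<in> G ` S"
    using that by (elim imageE) (simp add: bounded_linear_fromD(1)[OF G, symmetric])
  show "a - b \<in> G ` S" if "a \<in> G ` S" "b \<in> G ` S"
    using that by (elim imageE) (simp add: bounded_linear_from_diff[OF G, symmetric])
  show "sV c a \<in> G ` S" if "a \<in> G ` S"
    using that by (elim imageE) (simp add: bounded_linear_fromD(2)[OF G, symmetric])
qed

text \<open>By Baire, the images of balls are somewhere dense in the range; the differences of their
  elements are then dense in a ball about 0.\<close>

lemma (in inner_product_space) approximate_preimage:
  fixes G :: "'a \<Rightarrow> 'v::banach"
  assumes G: "bounded_linear_from scale S ip sV G" "closed (G ` S)"
    and sV: "\<And>r v. r *\<^sub>R v = sV (of_real r) v"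
  obtains K where "K \<ge> 0"
    "\<And>v e. v \<in> G ` S \<Longrightarrow> e > 0 \<Longrightarrow> \<exists>w\<in>S. ip_norm ip w \<le> K * norm v \<and> norm (v - G w) < e"
proof -
  let ?D = "G ` S"
  note G_add = bounded_linear_fromD(1)[OF G(1)] and G_diff = bounded_linear_from_diff[OF G(1)]
  have G_scaleR: "G (scale (of_real r) w) = r *\<^sub>R G w" if "w \<in> S" for r w
    using bounded_linear_fromD(2)[OF G(1) that] sV by simp
  \<comment> \<open>Closures make the sets closed, as Baire requires; they stay inside the range
    because the range is closed.\<close>
  define E where "E n = closure (G ` {w \<in> S. ip_norm ip w \<le> real n})" for n
  have cover: "?D = (\<Union>n. E n)"
  proof
    show "?D \<subseteq> (\<Union>n. E n)"
    proof
      fix v assume "v \<in> ?D"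
      then obtain w where w: "w \<in> S" "v = G w" by blast
      obtain n where "ip_norm ip w \<le> real n" using real_arch_simple by blast
      with w have "v \<in> E n" unfolding E_def by (intro subsetD[OF closure_subset]) blast
      then show "v \<in> (\<Union>n. E n)" by blast
    qed
    show "(\<Union>n. E n) \<subseteq> ?D"
      unfolding E_def using G(2) by (intro UN_least closure_minimal) auto
  qed
  have "?D \<noteq> {}" "\<And>n. closed (E n)" using S_simps(1) by (blast, simp add: E_def)
  then obtain n x r where x: "x \<in> ?D" and r: "r > 0" and sub: "ball x r \<inter> ?D \<subseteq> E n"
    by (rule Baire_closed_cover[OF G(2) _ _ cover])
  have approx: "\<exists>w\<in>S. ip_norm ip w \<le> real n \<and> norm (u - G w) < e"
    if "u \<in> ?D" "dist x u < r" "e > 0" for u e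
  proof -
    have "u \<in> E n" using that sub by auto
    with \<open>e > 0\<close> obtain y where "y \<in> G ` {w \<in> S. ip_norm ip w \<le> real n}" "dist y u < e"
      unfolding E_def closure_approachable by blast
    then show ?thesis by (auto simp: dist_norm norm_minus_commute)
  qed
  \<comment> \<open>Passing from the centre \<open>x\<close> to 0: approximate preimages
    \<open>u\<close> of \<open>x + v\<close> and \<open>w\<close> of \<open>x\<close> give the
    approximate preimage \<open>u - w\<close> of \<open>v\<close>. This doubles the norm bound, and
    each approximation may use half of the error.\<close>
  have small: "\<exists>w\<in>S. ip_norm ip w \<le> 2 * real n \<and> norm (v - G w) < e"
    if v: "v \<in> ?D" "norm v < r" and e: "e > 0" for v e
  proof -
    have "x + v \<in> ?D" using x v(1) by (rule bounded_linear_from_range(1)[OF G(1)])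
    then obtain u where u: "u \<in> S" "ip_norm ip u \<le> real n" "norm (x + v - G u) < e / 2"
      using approx[of "x + v" "e / 2"] v e by (auto simp: dist_norm)
    obtain w where w: "w \<in> S" "ip_norm ip w \<le> real n" "norm (x - G w) < e / 2"
      using approx[of x "e / 2"] x r e by auto
    have "ip_norm ip (u - w) \<le> ip_norm ip u + ip_norm ip w"
      using u w by (intro ip_norm_triangle_diff)
    moreover have "norm (v - G (u - w)) < e"
    proof -
      have "norm (v - G (u - w)) = norm ((x + v - G u) - (x - G w))"
        using u w by (simp add: G_diff algebra_simps)
      then show ?thesis
        using norm_triangle_ineq4[of "x + v - G u" "x - G w"] u(3) w(3) by linarith
    qed
    ultimately show ?thesis using u w by (intro bexI[of _ "u - w"]) auto
  qed
  show thesis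
  \<comment> \<open>The factor \<open>t = r / (2 * norm v)\<close> shrinks or stretches
    \<open>v\<close> to norm \<open>r / 2\<close>, where \<open>small\<close> applies. Dividing by
    \<open>t\<close> turns the bound \<open>2 * real n\<close> into
    \<open>4 * real n / r * norm v\<close>, and the tolerance \<open>t * e\<close> into
    \<open>e\<close>.\<close>
  proof (rule that[of "4 * real n / r"])
    fix v and e :: real assume v: "v \<in> ?D" and e: "e > 0"
    show "\<exists>w\<in>S. ip_norm ip w \<le> 4 * real n / r * norm v \<and> norm (v - G w) < e"
    proof (cases "v = 0")
      case True
      then show ?thesis
        using e G_diff[of 0 0] ip_norm_scale[of 0 0] by (intro bexI[of _ 0]) auto
    next
      case False
      define t where "t = r / (2 * norm v)"
      have t: "t > 0" using False r by (simp add: t_def)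
      have "t *\<^sub>R v \<in> ?D" using bounded_linear_from_range(3)[OF G(1) v] by (simp only: sV)
      moreover have "norm (t *\<^sub>R v) < r" using False r by (simp add: t_def)
      ultimately obtain w where w: "w \<in> S" "ip_norm ip w \<le> 2 * real n" "norm (t *\<^sub>R v - G w) < t * e"
        using small[of "t *\<^sub>R v" "t * e"] t e by auto
      have "norm (v - (1 / t) *\<^sub>R G w) = norm ((1 / t) *\<^sub>R (t *\<^sub>R v - G w))"
        using t by (simp add: scaleR_diff_right)
      also have "\<dots> = norm (t *\<^sub>R v - G w) / t" using t by simp
      also have "\<dots> < e" using w(3) t by (simp add: field_simps)
      finally have "norm (v - G (scale (of_real (1 / t)) w)) < e"
        using w(1) by (simp only: G_scaleR)
      moreover have "ip_norm ip (scale (of_real (1 / t)) w) = ip_norm ip w / t"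
        using w(1) t by (simp only: ip_norm_scale norm_of_real) simp
      moreover have "ip_norm ip w / t \<le> 4 * real n / r * norm v"
        using divide_right_mono[OF w(2), of t] t by (simp add: t_def)
      ultimately show ?thesis using w(1) by (intro bexI[of _ "scale (of_real (1 / t)) w"]) auto
    qed
  qed (use r in auto)
qed

text \<open>Successive approximation: each step corrects the remaining error approximately and at
  least halves it. The corrections decrease geometrically, so the partial sums converge by
  completeness, and by continuity of \<open>G\<close> the limit is an exact preimage.\<close>

lemma (in hilbert_space) open_mapping:
  fixes G :: "'a \<Rightarrow> 'v::banach"
  assumes G: "bounded_linear_from scale S ip sV G" "closed (G ` S)"
    and sV: "\<And>r v. r *\<^sub>R v = sV (of_real r) v"
  obtains C where "C \<ge> 0" "\<And>v. v \<in> G ` S \<Longrightarrow> \<exists>w\<in>S. G w = v \<and> ip_norm ip w \<le> C * norm v"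
proof -
  note G_add = bounded_linear_fromD(1)[OF G(1)] and G_diff = bounded_linear_from_diff[OF G(1)]
  obtain K where K: "K \<ge> 0"
    "\<And>v e. v \<in> G ` S \<Longrightarrow> e > 0 \<Longrightarrow> \<exists>w\<in>S. ip_norm ip w \<le> K * norm v \<and> norm (v - G w) < e"
    using approximate_preimage[OF assms] by blast
  obtain C0 where C0: "\<And>w. w \<in> S \<Longrightarrow> norm (G w) \<le> C0 * ip_norm ip w"
    using bounded_linear_fromD(3)[OF G(1)] by blast
  show thesis
  proof (rule that[of "2 * K"])
    fix v assume v: "v \<in> G ` S"
    show "\<exists>w\<in>S. G w = v \<and> ip_norm ip w \<le> 2 * K * norm v"
    proof (cases "v = 0")
      case True
      then show ?thesis
        using G_diff[of 0 0] ip_norm_scale[of 0 0] by (intro bexI[of _ 0]) auto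
    next
      case False
      \<comment> \<open>\<open>s n\<close> is the \<open>n\<close>-th partial sum of the
        corrections. The clause on \<open>n = 0\<close> fixes the start at 0, so that a bound on the
        increments from \<open>s 0\<close> bounds \<open>s n\<close> itself.\<close>
      have "\<exists>s. \<forall>n. (s n \<in> S \<and> norm (v - G (s n)) \<le> norm v / 2 ^ n \<and> (n = 0 \<longrightarrow> s n = 0)) \<and>
          ip_norm ip (s (Suc n) - s n) \<le> K * (norm v / 2 ^ n)"
      proof (rule dependent_nat_choice)
        show "\<exists>s. s \<in> S \<and> norm (v - G s) \<le> norm v / 2 ^ 0 \<and> (0 = (0::nat) \<longrightarrow> s = 0)"
          using G_diff[of 0 0] by auto
      next
        fix s n assume s: "s \<in> S \<and> norm (v - G s) \<le> norm v / 2 ^ n \<and> (n = 0 \<longrightarrow> s = 0)"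
        then have "v - G s \<in> G ` S" using v bounded_linear_from_range(2)[OF G(1)] by blast
        then obtain w where w: "w \<in> S" "ip_norm ip w \<le> K * norm (v - G s)"
            "norm (v - G s - G w) < norm v / 2 ^ Suc n"
          using K(2)[of "v - G s" "norm v / 2 ^ Suc n"] False by auto
        have "K * norm (v - G s) \<le> K * (norm v / 2 ^ n)"
          using s K(1) by (intro mult_left_mono) auto
        with w s show "\<exists>s'. (s' \<in> S \<and> norm (v - G s') \<le> norm v / 2 ^ Suc n \<and> (Suc n = 0 \<longrightarrow> s' = 0)) \<and>
            ip_norm ip (s' - s) \<le> K * (norm v / 2 ^ n)"
          by (intro exI[of _ "s + w"]) (auto simp: G_add algebra_simps)
      qed
      then obtain s where s: "\<And>n. s n \<in> S" "\<And>n. norm (v - G (s n)) \<le> norm v / 2 ^ n" "s 0 = 0"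
        and step: "\<And>n. ip_norm ip (s (Suc n) - s n) \<le> K * (norm v / 2 ^ n)" by blast
      \<comment> \<open>The right-hand side is the geometric sum of
        \<open>K * norm v / 2 ^ (n + i)\<close> over \<open>i < j\<close>.\<close>
      have incr: "ip_norm ip (s (n + j) - s n) \<le> 2 * K * norm v / 2 ^ n * (1 - 1 / 2 ^ j)" for n j
      proof (induction j)
        case 0
        then show ?case using ip_norm_scale[of 0 0] by auto
      next
        case (Suc j)
        have "ip_norm ip (s (n + Suc j) - s n)
            \<le> ip_norm ip (s (Suc (n + j)) - s (n + j)) + ip_norm ip (s (n + j) - s n)"
          using ip_norm_triangle[of "s (Suc (n + j)) - s (n + j)" "s (n + j) - s n"] s(1) by simp
        also have "\<dots> \<le> K * (norm v / 2 ^ (n + j)) + 2 * K * norm v / 2 ^ n * (1 - 1 / 2 ^ j)"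
          using step Suc by (intro add_mono) auto
        also have "\<dots> = 2 * K * norm v / 2 ^ n * (1 - 1 / 2 ^ Suc j)"
          by (simp add: field_simps power_add)
        finally show ?case .
      qed
      have tail: "ip_norm ip (s (n + j) - s n) \<le> 2 * K * norm v / 2 ^ n" for n j
      proof -
        have "2 * K * norm v / 2 ^ n * (1 - 1 / 2 ^ j) \<le> 2 * K * norm v / 2 ^ n * 1"
          using K(1) by (intro mult_left_mono) auto
        then show ?thesis using incr[of n j] by simp
      qed
      have pow: "(\<lambda>n. c / 2 ^ n) \<longlonglongrightarrow> 0" for c :: real
        using tendsto_mult[OF tendsto_const LIMSEQ_inverse_realpow_zero[of 2], of c]
        by (simp add: divide_inverse)
      have "\<exists>l\<in>S. (\<lambda>n. ip_norm ip (s n - l)) \<longlonglongrightarrow> 0"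
      proof (rule ip_complete[OF s(1)])
        fix e :: real assume e: "e > 0"
        \<comment> \<open>Both \<open>s m\<close> and \<open>s n\<close> lie within
          \<open>2 * K * norm v / 2 ^ N\<close> of \<open>s N\<close>, which accounts for the factor
          4.\<close>
        then obtain N where N: "4 * K * norm v / 2 ^ N < e"
          using order_tendstoD(2)[OF pow e, of "4 * K * norm v"] by (auto simp: eventually_sequentially)
        have "ip_norm ip (s m - s n) < e" if "m \<ge> N" "n \<ge> N" for m n
        proof -
          have "ip_norm ip (s m - s n) \<le> ip_norm ip (s m - s N) + ip_norm ip (s n - s N)"
            using ip_norm_triangle[of "s m - s N" "s N - s n"] s(1) ip_norm_diff_commute by simp
          also have "\<dots> \<le> 2 * K * norm v / 2 ^ N + 2 * K * norm v / 2 ^ N"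
            using tail[of N "m - N"] tail[of N "n - N"] that by (intro add_mono) auto
          finally show ?thesis using N by simp
        qed
        then show "\<exists>N. \<forall>m\<ge>N. \<forall>n\<ge>N. ip_norm ip (s m - s n) < e" by blast
      qed
      then obtain l where l: "l \<in> S" "(\<lambda>n. ip_norm ip (s n - l)) \<longlonglongrightarrow> 0" by blast
      have "ip_norm ip l \<le> 2 * K * norm v + 0"
      proof (rule LIMSEQ_le_const)
        show "(\<lambda>n. 2 * K * norm v + ip_norm ip (s n - l)) \<longlonglongrightarrow> 2 * K * norm v + 0"
          by (intro tendsto_intros l)
        have "ip_norm ip l \<le> 2 * K * norm v + ip_norm ip (s n - l)" for n
          using ip_norm_triangle[of "s n" "l - s n"] tail[of 0 n] s l(1) ip_norm_diff_commute[of "s n" l]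
          by simp
        then show "\<exists>N. \<forall>n\<ge>N. ip_norm ip l \<le> 2 * K * norm v + ip_norm ip (s n - l)" by blast
      qed
      \<comment> \<open>The error at \<open>l\<close> is at most the error at \<open>s n\<close>
        plus the norm of \<open>G (s n - l)\<close>. Both tend to 0, hence
        \<open>G l = v\<close>.\<close>
      moreover have "norm (v - G l) \<le> 0 + C0 * 0"
      proof (rule LIMSEQ_le_const)
        show "(\<lambda>n. norm v / 2 ^ n + C0 * ip_norm ip (s n - l)) \<longlonglongrightarrow> 0 + C0 * 0"
          by (intro tendsto_intros l pow)
        have "norm (v - G l) \<le> norm v / 2 ^ n + C0 * ip_norm ip (s n - l)" for n
          using norm_triangle_ineq[of "v - G (s n)" "G (s n - l)"] C0[of "s n - l"] s(1,2)[of n] l(1)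
          by (simp add: G_diff)
        then show "\<exists>N. \<forall>n\<ge>N. norm (v - G l) \<le> norm v / 2 ^ n + C0 * ip_norm ip (s n - l)" by blast
      qed
      ultimately show ?thesis using l(1) by (intro bexI[of _ l]) auto
    qed
  qed (use K in auto)
qed

section \<open>Range space relations\<close>

text \<open>\<open>R\<close> is the image of a Hilbert space under a bounded map \<open>F\<close>.
  The open mapping theorem for \<open>P \<circ> F\<close> yields a parameter \<open>w\<close> of
  controlled norm, and \<open>F w\<close> is the wanted element of \<open>R\<close>. The cases of
  interest are \<open>P = fst\<close> and \<open>P = snd\<close>.\<close>

lemma range_space_relation_lift:
  fixes P :: "'x::real_normed_vector \<times> 'y::real_normed_vector \<Rightarrow> 'v::banach"
  assumes R: "range_space_relation sX sY R" and closed: "closed (P ` R)"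
    and P: "\<And>p q. P (p + q) = P p + P q" "\<And>c p. P (scale_prod sX sY c p) = sV c (P p)"
      "\<And>p. norm (P p) \<le> norm p"
    and sV: "\<And>r v. r *\<^sub>R v = sV (of_real r) v"
  obtains C where "C \<ge> 0" "\<And>v. v \<in> P ` R \<Longrightarrow> \<exists>p\<in>R. P p = v \<and> norm p \<le> C * norm v"
proof -
  obtain W :: "('x \<times> 'y) set" and ip F
    where W: "hilbert_space (scale_prod sX sY) W ip"
      and F: "bounded_linear_from (scale_prod sX sY) W ip (scale_prod sX sY) F" and R_eq: "F ` W = R"
    using R unfolding range_space_relation_def by blast
  interpret W: hilbert_space "scale_prod sX sY" W ip by fact
  obtain C0 where C0: "\<And>w. w \<in> W \<Longrightarrow> norm (F w) \<le> C0 * ip_norm ip w"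
    using bounded_linear_fromD(3)[OF F] by blast
  have "norm ((P \<circ> F) w) \<le> C0 * ip_norm ip w" if "w \<in> W" for w
    using C0[OF that] P(3)[of "F w"] by simp
  then have PF: "bounded_linear_from (scale_prod sX sY) W ip sV (P \<circ> F)"
    using bounded_linear_fromD(1,2)[OF F] unfolding bounded_linear_from_def
    by (intro conjI ballI allI exI[of _ C0]) (simp_all add: P(1,2))
  have PR: "(P \<circ> F) ` W = P ` R" unfolding R_eq[symmetric] by (rule image_comp[symmetric])
  obtain C where C: "C \<ge> 0" "\<And>v. v \<in> P ` R \<Longrightarrow> \<exists>w\<in>W. (P \<circ> F) w = v \<and> ip_norm ip w \<le> C * norm v"
    using W.open_mapping[OF PF _ sV] closed unfolding PR by blast
  show thesis
  \<comment> \<open>The sign of \<open>C0\<close> is unknown; the absolute value makes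
    multiplication by it monotone and the final constant nonnegative.\<close>
  proof (rule that[of "\<bar>C0\<bar> * C"])
    fix v assume "v \<in> P ` R"
    then obtain w where w: "w \<in> W" "P (F w) = v" "ip_norm ip w \<le> C * norm v" using C(2) unfolding comp_def by blast
    have "norm (F w) \<le> \<bar>C0\<bar> * ip_norm ip w"
      using C0[OF w(1)] mult_right_mono[OF abs_ge_self W.ip_norm_nonneg, of C0 w] by linarith
    also have "\<dots> \<le> \<bar>C0\<bar> * (C * norm v)" using w(3) by (intro mult_left_mono) auto
    finally show "\<exists>p\<in>R. P p = v \<and> norm p \<le> \<bar>C0\<bar> * C * norm v"
      using w(1,2) R_eq by (intro bexI[of _ "F w"]) (simp_all add: mult.assoc imageI flip: R_eq)
  qed (use C in auto)
qed

text \<open>Only some \<open>y\<close> can be bounded: the values at \<open>x\<close> form a coset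
  of \<open>mul_rel R\<close>.\<close>

lemma range_space_relation_Domain_bound:
  fixes R :: "('x::banach \<times> 'y::real_normed_vector) set"
  assumes "hilbert_type sX ipX" "range_space_relation sX sY R" "closed (Domain R)"
  obtains C where "C \<ge> 0" "\<And>x. x \<in> Domain R \<Longrightarrow> \<exists>y. (x, y) \<in> R \<and> norm y \<le> C * norm x"
proof -
  have closed: "closed (fst ` R)" using assms(3) by (simp only: Domain_fst)
  have norm_le: "norm (fst p) \<le> norm p" for p :: "'x \<times> 'y"
    by (cases p) (simp add: norm_fst_le)
  obtain C where C: "C \<ge> 0" "\<And>x. x \<in> fst ` R \<Longrightarrow> \<exists>p\<in>R. fst p = x \<and> norm p \<le> C * norm x"
    by (rule range_space_relation_lift[OF assms(2) closed _ _ norm_le hilbert_type.scaleR_eq_scale[OF assms(1)]])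
      (simp, simp add: scale_prod_def, blast)
  show thesis
  proof (rule that[OF C(1)])
    fix x assume "x \<in> Domain R"
    then obtain p where "p \<in> R" "fst p = x" "norm p \<le> C * norm x" using C(2) unfolding Domain_fst by blast
    then show "\<exists>y. (x, y) \<in> R \<and> norm y \<le> C * norm x"
      using norm_snd_le[of "snd p" "fst p"] by (intro exI[of _ "snd p"]) auto
  qed
qed

text \<open>The mirror image under inversion of \<open>R\<close>, obtained from the second
  projection.\<close>

lemma range_space_relation_Range_bound:
  fixes R :: "('x::real_normed_vector \<times> 'y::banach) set"
  assumes "hilbert_type sY ipY" "range_space_relation sX sY R" "closed (Range R)"
  obtains C where "C \<ge> 0" "\<And>y. y \<in> Range R \<Longrightarrow> \<exists>x. (x, y) \<in> R \<and> norm x \<le> C * norm y"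
proof -
  have closed: "closed (snd ` R)" using assms(3) by (simp only: Range_snd)
  have norm_le: "norm (snd p) \<le> norm p" for p :: "'x \<times> 'y"
    by (cases p) (simp add: norm_snd_le)
  obtain C where C: "C \<ge> 0" "\<And>y. y \<in> snd ` R \<Longrightarrow> \<exists>p\<in>R. snd p = y \<and> norm p \<le> C * norm y"
    by (rule range_space_relation_lift[OF assms(2) closed _ _ norm_le hilbert_type.scaleR_eq_scale[OF assms(1)]])
      (simp, simp add: scale_prod_def, blast)
  show thesis
  proof (rule that[OF C(1)])
    fix y assume "y \<in> Range R"
    then obtain p where "p \<in> R" "snd p = y" "norm p \<le> C * norm y" using C(2) unfolding Range_snd by blast
    then show "\<exists>x. (x, y) \<in> R \<and> norm x \<le> C * norm y"
      using norm_fst_le[of "fst p" "snd p"] by (intro exI[of _ "fst p"]) auto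
  qed
qed

section \<open>Algebra of linear relations\<close>

lemma linear_relation_iff:
  assumes "vector_space sX" "vector_space sY"
  shows "linear_relation sX sY R \<longleftrightarrow> (0, 0) \<in> R \<and>
    (\<forall>x y x' y'. (x, y) \<in> R \<longrightarrow> (x', y') \<in> R \<longrightarrow> (x + x', y + y') \<in> R) \<and>
    (\<forall>c x y. (x, y) \<in> R \<longrightarrow> (sX c x, sY c y) \<in> R)"
proof -
  interpret vector_space "scale_prod sX sY" using assms by (rule vector_space_scale_prod)
  show ?thesis by (auto simp: linear_relation_def subspace_def scale_prod_def zero_prod_def Ball_def)
qed

lemma linear_relation_add:
  assumes "vector_space sX" "vector_space sY" "linear_relation sX sY R" "(x, y) \<in> R" "(x', y') \<in> R"
  shows "(x + x', y + y') \<in> R"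
  using assms(3-) by (simp add: linear_relation_iff[OF assms(1,2)])

lemma linear_relation_diff:
  assumes "vector_space sX" "vector_space sY" "linear_relation sX sY R" "(x, y) \<in> R" "(x', y') \<in> R"
  shows "(x - x', y - y') \<in> R"
proof -
  interpret vector_space "scale_prod sX sY" by (rule vector_space_scale_prod) fact+
  show ?thesis using subspace_diff[of R "(x, y)" "(x', y')"] assms by (simp add: linear_relation_def)
qed

lemma subspace_mul_rel:
  assumes "vector_space sX" "vector_space sY" "linear_relation sX sY R"
  shows "module.subspace sY (mul_rel R)"
proof -
  interpret X: vector_space sX by fact
  interpret Y: vector_space sY by fact
  show ?thesis
    using assms(3) X.scale_zero_right unfolding linear_relation_iff[OF assms(1,2)]
    by (intro Y.subspaceI; unfold mul_rel_def mem_Collect_eq; metis add_0)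
qed

lemma hilbert_type_vector_space: "hilbert_type sX ipX \<Longrightarrow> vector_space sX"
  by (simp add: hilbert_type_def inner_product_space_def)

text \<open>For a limit \<open>l\<close> of elements \<open>f n\<close> of \<open>mul_rel R\<close>,
  take \<open>(x, l) \<in> R\<close> and correct it by pairs \<open>(u n, l - f n)\<close> in
  \<open>R\<close> with \<open>u n\<close> tending to 0. Then \<open>x - u n\<close> lies in the
  closed kernel, so does its limit \<open>x\<close>, and \<open>(x, l) - (x, 0)\<close> is
  \<open>(0, l)\<close>.\<close>

lemma closed_mul_rel:
  fixes R :: "('x::banach \<times> 'y::banach) set"
  assumes X: "hilbert_type sX ipX" and Y: "hilbert_type sY ipY" and R: "range_space_relation sX sY R"
    and closed: "closed (Range R)" "closed (ker_rel R)"
  shows "closed (mul_rel R)"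
proof -
  have lin: "linear_relation sX sY R" using R by (simp add: range_space_relation_def)
  note diff = linear_relation_diff[OF X[THEN hilbert_type_vector_space] Y[THEN hilbert_type_vector_space] lin]
  obtain C where C: "C \<ge> 0" "\<And>y. y \<in> Range R \<Longrightarrow> \<exists>x. (x, y) \<in> R \<and> norm x \<le> C * norm y"
    using range_space_relation_Range_bound[OF Y R closed(1)] by blast
  show ?thesis
    unfolding closed_sequential_limits
  proof (intro allI impI, elim conjE)
    fix f l assume f: "\<forall>n. f n \<in> mul_rel R" and l: "f \<longlonglongrightarrow> l"
    have f0: "(0, f n) \<in> R" for n using f by (simp add: mul_rel_def)
    have "l \<in> Range R" using closed_sequentially[OF closed(1) _ l] f0 by blast
    then obtain x where x: "(x, l) \<in> R" by blast
    then have "\<exists>u. (u, l - f n) \<in> R \<and> norm u \<le> C * norm (l - f n)" for n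
      using C(2)[of "l - f n"] diff[OF x f0] by blast
    then obtain u where u: "\<And>n. (u n, l - f n) \<in> R" "\<And>n. norm (u n) \<le> C * norm (l - f n)" by metis
    have "(\<lambda>n. C * norm (l - f n)) \<longlonglongrightarrow> C * norm (l - l)" by (intro tendsto_intros l)
    then have "u \<longlonglongrightarrow> 0"
      by (intro Lim_null_comparison[of u "\<lambda>n. C * norm (l - f n)"]) (simp_all add: u)
    then have lim: "(\<lambda>n. x - u n) \<longlonglongrightarrow> x" using tendsto_diff[OF tendsto_const, of u 0 _ x] by simp
    \<comment> \<open>\<open>(x - u n, 0)\<close> equals
      \<open>(x, l) - (u n, l - f n) - (0, f n)\<close>.\<close>
    have "x - u n \<in> ker_rel R" for n
      using diff[OF diff[OF x u(1)] f0, of n n] by (simp add: ker_rel_def)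
    then have "x \<in> ker_rel R" using closed_sequentially[OF closed(2) _ lim] by blast
    then show "l \<in> mul_rel R" using diff[OF x, of x 0] by (simp add: ker_rel_def mul_rel_def)
  qed
qed

section \<open>Orthogonality and closed subspaces\<close>

context hilbert_type
begin

lemma norm_scale: "norm (scale c x) = norm c * norm x"
  using ip_norm_scale[of x c] by (simp add: norm_eq_ip_norm)

lemma bounded_linear_scale: "bounded_linear (scale c)"
  by (rule bounded_linear_intro[of _ "norm c"])
    (simp_all add: scale_right_distrib norm_scale scaleR_eq_scale mult.commute)

text \<open>Translates between the topology of the type and the convergence in
  \<open>ip_norm\<close> that \<open>hilbert_space\<close> speaks of.\<close>

lemma tendsto_iff_ip_norm: "(f \<longlongrightarrow> l) F \<longleftrightarrow> ((\<lambda>n. ip_norm ip (f n - l)) \<longlongrightarrow> 0) F"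
  unfolding norm_eq_ip_norm[symmetric] tendsto_norm_zero_iff by (rule LIM_zero_iff[symmetric])

lemma norm_le_norm_add_orthogonal:
  assumes "ip x y = 0"
  shows "norm x \<le> norm (x + y)" "norm y \<le> norm (x + y)"
proof -
  have "(norm (x + y))\<^sup>2 = (norm x)\<^sup>2 + (norm y)\<^sup>2"
    using pythagoras[of x y] assms by (simp add: norm_eq_ip_norm)
  then show "norm x \<le> norm (x + y)" "norm y \<le> norm (x + y)"
    by (simp_all add: power2_le_imp_le)
qed

lemma closed_subspace_decomposition:
  assumes "subspace N" "closed N"
  obtains n u where "w = u + n" "n \<in> N" "\<And>m. m \<in> N \<Longrightarrow> ip u m = 0"
proof -
  have "\<exists>n\<in>N. \<forall>m\<in>N. ip (w - n) m = 0"
  proof (rule orthogonal_decomposition)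
    fix f l assume "\<And>n. f n \<in> N" "(\<lambda>n. ip_norm ip (f n - l)) \<longlonglongrightarrow> 0"
    then show "l \<in> N"
      using closed_sequentially[OF assms(2)] tendsto_iff_ip_norm by blast
  qed (use assms in auto)
  then obtain n where "n \<in> N" "\<forall>m\<in>N. ip (w - n) m = 0" by blast
  then show thesis by (intro that[of "w - n" n]) auto
qed

text \<open>Cauchy sequences in \<open>N\<close> converge in the whole space, and closedness keeps
  the limit in \<open>N\<close>.\<close>

lemma hilbert_space_closed_subspace:
  assumes "subspace N" "closed N"
  shows "hilbert_space scale N ip"
proof unfold_locales
  fix f :: "nat \<Rightarrow> 'a"
  assume f: "\<And>n. f n \<in> N" and "\<And>e. e > 0 \<Longrightarrow> \<exists>K. \<forall>m\<ge>K. \<forall>n\<ge>K. ip_norm ip (f m - f n) < e"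
  then obtain l where "(\<lambda>n. ip_norm ip (f n - l)) \<longlonglongrightarrow> 0" using ip_complete[of f] by blast
  moreover from this have "f \<longlonglongrightarrow> l"
    by (simp add: tendsto_iff_ip_norm)
  ultimately show "\<exists>l\<in>N. (\<lambda>n. ip_norm ip (f n - l)) \<longlonglongrightarrow> 0"
    using closed_sequentially[OF assms(2)] f by blast
qed (use assms(1) in \<open>auto intro: ip_add_left ip_scale_left ip_commute ip_nonneg ip_definite\<close>)

end

text \<open>The sum of the two inner products induces the norm
  \<open>sqrt ((norm x)\<^sup>2 + (norm y)\<^sup>2)\<close>, which is the norm of the product
  type.\<close>

lemma hilbert_type_prod:
  assumes "hilbert_type sX ipX" "hilbert_type sY ipY"
  shows "hilbert_type (scale_prod sX sY) (\<lambda>p q. ipX (fst p) (fst q) + ipY (snd p) (snd q))"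
    (is "hilbert_type _ ?ip")
proof -
  interpret X: hilbert_type sX ipX by fact
  interpret Y: hilbert_type sY ipY by fact
  interpret vector_space "scale_prod sX sY"
    by (rule vector_space_scale_prod) (rule X.vector_space_axioms, rule Y.vector_space_axioms)
  \<comment> \<open>This formula yields nonnegativity, definiteness and the agreement of the
    norms.\<close>
  have self: "?ip p p = of_real ((norm (fst p))\<^sup>2 + (norm (snd p))\<^sup>2)" for p
    by (simp add: X.ip_self Y.ip_self X.norm_eq_ip_norm Y.norm_eq_ip_norm)
  show ?thesis
  proof unfold_locales
    show "subspace UNIV" by (rule subspace_UNIV)
    show "?ip (p + q) r = ?ip p r + ?ip q r" for p q r
      by (simp add: X.ip_add_left Y.ip_add_left)
    show "?ip (scale_prod sX sY c p) q = c * ?ip p q" for c p q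
      by (simp add: scale_prod_def X.ip_scale_left Y.ip_scale_left distrib_left)
    show "?ip q p = kcnj (?ip p q)" for p q
      by (simp add: X.ip_commute[of "fst p" "fst q"] Y.ip_commute[of "snd p" "snd q"] kcnj_add)
    show "\<exists>r\<ge>0. ?ip p p = of_real r" for p
      unfolding self by (rule exI[of _ "(norm (fst p))\<^sup>2 + (norm (snd p))\<^sup>2"]) simp
    show "p = 0" if "?ip p p = 0" for p
      using that unfolding self of_real_eq_0_iff by (simp add: add_nonneg_eq_0_iff prod_eq_iff)
    show "norm p = ip_norm ?ip p" for p
      unfolding ip_norm_def self norm_of_real by (simp add: norm_prod_def)
    show "r *\<^sub>R p = scale_prod sX sY (of_real r) p" for r p
      by (simp add: scale_prod_def scaleR_prod_def X.scaleR_eq_scale Y.scaleR_eq_scale)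
  qed
qed

text \<open>A closed linear relation is a closed subspace of the product Hilbert space, so it can
  serve as \<open>W\<close> itself, with the identity as \<open>F\<close>.\<close>

lemma range_space_relation_closed:
  fixes R :: "('x::banach \<times> 'y::banach) set"
  assumes "hilbert_type sX ipX" "hilbert_type sY ipY" "linear_relation sX sY R" "closed R"
  shows "range_space_relation sX sY R"
proof -
  interpret hilbert_type "scale_prod sX sY" "\<lambda>p q. ipX (fst p) (fst q) + ipY (snd p) (snd q)"
    by (rule hilbert_type_prod) fact+
  have "bounded_linear_from (scale_prod sX sY) R (\<lambda>p q. ipX (fst p) (fst q) + ipY (snd p) (snd q))
      (scale_prod sX sY) id"
    unfolding bounded_linear_from_def norm_eq_ip_norm by (auto intro: exI[of _ 1])
  moreover have "hilbert_space (scale_prod sX sY) R (\<lambda>p q. ipX (fst p) (fst q) + ipY (snd p) (snd q))"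
    using hilbert_space_closed_subspace[of R] assms(3,4) by (simp add: linear_relation_def)
  moreover have "id ` R = R" by simp
  ultimately show ?thesis
    using assms(3) unfolding range_space_relation_def by blast
qed

lemma linear_relation_closure:
  assumes "hilbert_type sX ipX" "hilbert_type sY ipY" "linear_relation sX sY R"
  shows "linear_relation sX sY (closure R)"
proof -
  interpret hilbert_type "scale_prod sX sY" "\<lambda>p q. ipX (fst p) (fst q) + ipY (snd p) (snd q)"
    by (rule hilbert_type_prod) fact+
  have R: "subspace R" using assms(3) by (simp add: linear_relation_def)
  have "subspace (closure R)"
  proof (rule subspaceI)
    show "0 \<in> closure R" using subspace_0[OF R] closure_subset by blast
    show "p + q \<in> closure R" if "p \<in> closure R" "q \<in> closure R" for p q
    proof -
      obtain f g where "\<forall>n. f n \<in> R" "f \<longlonglongrightarrow> p" "\<forall>n. g n \<in> R" "g \<longlonglongrightarrow> q"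
        using \<open>p \<in> closure R\<close> \<open>q \<in> closure R\<close> unfolding closure_sequential by blast
      then show ?thesis unfolding closure_sequential
        by (intro exI[of _ "\<lambda>n. f n + g n"]) (auto intro: tendsto_add subspace_add[OF R])
    qed
    show "scale_prod sX sY c p \<in> closure R" if "p \<in> closure R" for c p
    proof -
      obtain f where "\<forall>n. f n \<in> R" "f \<longlonglongrightarrow> p"
        using \<open>p \<in> closure R\<close> unfolding closure_sequential by blast
      then show ?thesis unfolding closure_sequential
        by (intro exI[of _ "\<lambda>n. scale_prod sX sY c (f n)"])
          (auto intro: bounded_linear.tendsto[OF bounded_linear_scale] subspace_scale[OF R])
    qed
  qed
  then show ?thesis by (simp add: linear_relation_def)
qed

text \<open>By the bound, values over a convergent sequence in the domain form a Cauchy sequence;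
  the limit pair belongs to \<open>R\<close> because \<open>R\<close> is closed.\<close>

lemma closed_Domain_bounded:
  fixes R :: "('x::banach \<times> 'y::banach) set"
  assumes "vector_space sX" "vector_space sY" "linear_relation sX sY R" "closed R"
    and C: "\<And>x y. (x, y) \<in> R \<Longrightarrow> norm y \<le> C * norm x"
  shows "closed (Domain R)"
  unfolding closed_sequential_limits
proof (intro allI impI, elim conjE)
  fix f l assume f: "\<forall>n. f n \<in> Domain R" and l: "f \<longlonglongrightarrow> l"
  have "\<forall>n. \<exists>y. (f n, y) \<in> R" using f by blast
  then obtain g where g: "\<And>n. (f n, g n) \<in> R" by metis
  have "Cauchy g"
  proof (rule CauchyI)
    fix e :: real assume e: "e > 0"
    \<comment> \<open>\<open>\<bar>C\<bar> + 1\<close> is positive and at least \<open>C\<close>,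
      whatever the sign of \<open>C\<close>.\<close>
    have "e / (\<bar>C\<bar> + 1) > 0" using e by simp
    then obtain M where M: "\<And>m n. m \<ge> M \<Longrightarrow> n \<ge> M \<Longrightarrow> norm (f m - f n) < e / (\<bar>C\<bar> + 1)"
      using LIMSEQ_imp_Cauchy[OF l] unfolding Cauchy_iff by blast
    have "norm (g m - g n) < e" if "m \<ge> M" "n \<ge> M" for m n
    proof -
      have "norm (g m - g n) \<le> C * norm (f m - f n)"
        using C linear_relation_diff[OF assms(1-3) g g] by blast
      also have "\<dots> \<le> (\<bar>C\<bar> + 1) * norm (f m - f n)" by (intro mult_right_mono) auto
      also have "\<dots> < (\<bar>C\<bar> + 1) * (e / (\<bar>C\<bar> + 1))"
        using M[OF that] by (intro mult_strict_left_mono) auto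
      finally show ?thesis by simp
    qed
    then show "\<exists>M. \<forall>m\<ge>M. \<forall>n\<ge>M. norm (g m - g n) < e" by blast
  qed
  then obtain k where "g \<longlonglongrightarrow> k" using Cauchy_convergent convergent_def by blast
  then have "(\<lambda>n. (f n, g n)) \<longlonglongrightarrow> (l, k)" using l by (intro tendsto_Pair)
  then have "(l, k) \<in> R" by (rule closed_sequentially[OF assms(4) g])
  then show "l \<in> Domain R" by blast
qed

section \<open>Factorization\<close>

text \<open>The norm bound and the inclusion in \<open>mul_rel B \<times> mul_rel (B O T)\<close>
  are closed conditions, so both pass from the restriction of \<open>T\<close> to its closure. The
  range cannot grow, since the restriction is already onto \<open>mul_rel (B O T)\<close>.\<close>

lemma mul_operator_if_factor:
  fixes sX :: "'k::real_or_complex \<Rightarrow> 'x::banach \<Rightarrow> 'x"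
    and sY :: "'k \<Rightarrow> 'y::banach \<Rightarrow> 'y" and sZ :: "'k \<Rightarrow> 'z::banach \<Rightarrow> 'z"
    and B :: "('x \<times> 'z) set" and T :: "('z \<times> 'y) set"
  assumes Y: "hilbert_type sY ipY" and Z: "hilbert_type sZ ipZ"
    and mul: "closed (mul_rel B)" "module.subspace sZ (mul_rel B)"
      "closed (mul_rel (B O T))" "module.subspace sY (mul_rel (B O T))"
    and T: "bounded_operator_graph sZ sY T"
  shows "\<exists>Tmul. range_space_operator sZ sY Tmul \<and> Tmul \<subseteq> mul_rel B \<times> mul_rel (B O T) \<and>
      closedin (top_of_set (mul_rel B)) (Domain Tmul) \<and> Range Tmul = mul_rel (B O T)"
proof -
  interpret Y: hilbert_type sY ipY by fact
  interpret Z: hilbert_type sZ ipZ by fact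
  note vs = Z.vector_space_axioms Y.vector_space_axioms
  let ?M = "mul_rel B" and ?N = "mul_rel (B O T)"
  have linT: "linear_relation sZ sY T" and "\<exists>C. \<forall>(z, y)\<in>T. norm y \<le> C * norm z"
    using T by (simp_all add: bounded_operator_graph_def linear_operator_graph_def)
  then obtain C where C: "\<And>z y. (z, y) \<in> T \<Longrightarrow> norm y \<le> C * norm z" by fast
  let ?R = "T \<inter> ?M \<times> ?N"
  have "linear_relation sZ sY ?R"
    using linT Z.subspace_0[OF mul(2)] Y.subspace_0[OF mul(4)] Z.subspace_add[OF mul(2)] Y.subspace_add[OF mul(4)]
      Z.subspace_scale[OF mul(2)] Y.subspace_scale[OF mul(4)]
    unfolding linear_relation_iff[OF vs] by simp
  then have lin: "linear_relation sZ sY (closure ?R)" by (rule linear_relation_closure[OF Z Y])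
  have "closure ?R \<subseteq> {p. norm (snd p) \<le> C * norm (fst p)}"
    by (intro closure_minimal closed_Collect_le continuous_intros) (auto intro: C)
  then have bound: "norm y \<le> C * norm z" if "(z, y) \<in> closure ?R" for z y using that by auto
  have sub: "closure ?R \<subseteq> ?M \<times> ?N"
    using mul(1,3) by (intro closure_minimal closed_Times) auto
  have "range_space_relation sZ sY (closure ?R)"
    by (rule range_space_relation_closed[OF Z Y lin closed_closure])
  \<comment> \<open>At \<open>z = 0\<close> the bound forces \<open>y = 0\<close>, so the closure is
    again an operator.\<close>
  moreover have "mul_rel (closure ?R) = {0}"
    using bound[of 0] lin unfolding linear_relation_iff[OF vs] mul_rel_def by fastforce
  moreover have "closed (Domain (closure ?R))"
    using bound by (rule closed_Domain_bounded[OF vs lin closed_closure])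
  then have "closedin (top_of_set ?M) (Domain (closure ?R))"
    using sub by (intro closed_subset) auto
  \<comment> \<open>If \<open>(0, z) \<in> B\<close> and \<open>(z, y) \<in> T\<close>, then
    \<open>z\<close> lies in \<open>mul_rel B\<close>, so \<open>(z, y)\<close> is in the
    restriction.\<close>
  moreover have "?N \<subseteq> Range ?R"
    unfolding mul_rel_def by blast
  then have "Range (closure ?R) = ?N"
    using sub closure_subset[of ?R] by blast
  ultimately show ?thesis
    using lin sub unfolding range_space_operator_def linear_operator_graph_def by blast
qed

text \<open>A version of the closed graph theorem: the controlled value over \<open>x\<close> given
  by the open mapping theorem is the only value, because \<open>T\<close> is single-valued.\<close>

lemma range_space_operator_bounded:
  fixes T :: "('x::banach \<times> 'y::banach) set"
  assumes X: "hilbert_type sX ipX" and Y: "hilbert_type sY ipY"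
    and T: "range_space_operator sX sY T" and closed: "closed (Domain T)"
  obtains C where "C \<ge> 0" "\<And>x y. (x, y) \<in> T \<Longrightarrow> norm y \<le> C * norm x"
proof -
  have lin: "linear_relation sX sY T" and mul: "mul_rel T = {0}" and R: "range_space_relation sX sY T"
    using T unfolding range_space_operator_def linear_operator_graph_def by blast+
  obtain C where C: "C \<ge> 0" "\<And>x. x \<in> Domain T \<Longrightarrow> \<exists>y. (x, y) \<in> T \<and> norm y \<le> C * norm x"
    using range_space_relation_Domain_bound[OF X R closed] by blast
  show thesis
  proof (rule that[OF C(1)])
    fix x y assume xy: "(x, y) \<in> T"
    then obtain y' where y': "(x, y') \<in> T" "norm y' \<le> C * norm x" using C(2) by blast
    have "y - y' \<in> mul_rel T"
      using linear_relation_diff[OF X[THEN hilbert_type_vector_space] Y[THEN hilbert_type_vector_space]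
          lin xy y'(1)] by (simp add: mul_rel_def)
    then show "norm y \<le> C * norm x" using mul y'(2) by simp
  qed
qed

lemma factor_if_mul_operator:
  fixes sX :: "'k::real_or_complex \<Rightarrow> 'x::banach \<Rightarrow> 'x"
    and sY :: "'k \<Rightarrow> 'y::banach \<Rightarrow> 'y" and sZ :: "'k \<Rightarrow> 'z::banach \<Rightarrow> 'z"
    and A :: "('x \<times> 'y) set" and B :: "('x \<times> 'z) set"
  assumes X: "hilbert_type sX ipX" and Y: "hilbert_type sY ipY" and Z: "hilbert_type sZ ipZ"
    and A: "range_space_relation sX sY A" "closed (Domain A)" "closed (mul_rel A)"
    and B: "range_space_relation sX sZ B" "closed (Range B)" "closed (mul_rel B)"
    and dom: "Domain A \<subseteq> Domain B" and ker: "ker_rel B \<subseteq> ker_rel A"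
    and S: "range_space_operator sZ sY S" "closed (Domain S)" "S \<subseteq> mul_rel B \<times> mul_rel A"
      "Range S = mul_rel A"
  shows "\<exists>T. bounded_operator_graph sZ sY T \<and> A = B O T"
proof -
  interpret X: hilbert_type sX ipX by fact
  interpret Y: hilbert_type sY ipY by fact
  interpret Z: hilbert_type sZ ipZ by fact
  note XY = X.vector_space_axioms Y.vector_space_axioms and XZ = X.vector_space_axioms Z.vector_space_axioms
    and ZY = Z.vector_space_axioms Y.vector_space_axioms
  have linA: "linear_relation sX sY A" and linB: "linear_relation sX sZ B"
    using A(1) B(1) by (simp_all add: range_space_relation_def)
  have linS: "linear_relation sZ sY S"
    using S(1) by (simp add: range_space_operator_def linear_operator_graph_def)
  note A_add = linear_relation_add[OF XY linA] and A_diff = linear_relation_diff[OF XY linA]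
    and B_add = linear_relation_add[OF XZ linB] and B_diff = linear_relation_diff[OF XZ linB]
  have mulA: "Y.subspace (mul_rel A)" and mulB: "Z.subspace (mul_rel B)"
    by (rule subspace_mul_rel[OF XY linA], rule subspace_mul_rel[OF XZ linB])
  \<comment> \<open>The condition on \<open>y\<close> selects the element of least norm in its coset
    of \<open>mul_rel A\<close>, which gives boundedness. The condition on \<open>z\<close> makes
    the domain orthogonal to that of \<open>S\<close>, so that the bounds of \<open>R\<close> and
    \<open>S\<close> can be combined.\<close>
  define R where "R = {(z, y). (\<exists>x. (x, z) \<in> B \<and> (x, y) \<in> A) \<and>
    (\<forall>m\<in>mul_rel B. ipZ z m = 0) \<and> (\<forall>n\<in>mul_rel A. ipY y n = 0)}"
  define T where "T = {(z + z', y + y') | z y z' y'. (z, y) \<in> R \<and> (z', y') \<in> S}"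
  \<comment> \<open>Two \<open>B\<close>-preimages of \<open>z\<close> differ by an element of
    \<open>ker_rel B\<close>, hence of \<open>ker_rel A\<close>; so they have the same values under
    \<open>A\<close>.\<close>
  have transfer: "(x', y) \<in> A" if "(x, z) \<in> B" "(x', z) \<in> B" "(x, y) \<in> A" for x x' y z
  proof -
    have "x - x' \<in> ker_rel B" using B_diff[OF that(1,2)] by (simp add: ker_rel_def)
    then have "(x - x', 0) \<in> A" using ker by (auto simp: ker_rel_def)
    then show ?thesis using A_diff[OF that(3)] by fastforce
  qed
  obtain CA where CA: "CA \<ge> 0" "\<And>x. x \<in> Domain A \<Longrightarrow> \<exists>y. (x, y) \<in> A \<and> norm y \<le> CA * norm x"
    using range_space_relation_Domain_bound[OF X A(1,2)] by blast
  obtain CB where CB: "CB \<ge> 0" "\<And>z. z \<in> Range B \<Longrightarrow> \<exists>x. (x, z) \<in> B \<and> norm x \<le> CB * norm z"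
    using range_space_relation_Range_bound[OF Z B(1,2)] by blast
  obtain CS where CS: "CS \<ge> 0" "\<And>z y. (z, y) \<in> S \<Longrightarrow> norm y \<le> CS * norm z"
    using range_space_operator_bounded[OF Z Y S(1,2)] by blast
  have boundR: "norm y \<le> CA * CB * norm z" if "(z, y) \<in> R" for z y
  proof -
    obtain x where x: "(x, z) \<in> B" "(x, y) \<in> A" and y: "\<And>n. n \<in> mul_rel A \<Longrightarrow> ipY y n = 0"
      using \<open>(z, y) \<in> R\<close> unfolding R_def by blast
    obtain x' where x': "(x', z) \<in> B" "norm x' \<le> CB * norm z" using CB(2) x(1) by blast
    have x'y: "(x', y) \<in> A" using x x'(1) transfer by blast
    then obtain y' where y': "(x', y') \<in> A" "norm y' \<le> CA * norm x'" using CA(2) by blast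
    have "y' - y \<in> mul_rel A" using A_diff[OF y'(1) x'y] by (simp add: mul_rel_def)
    \<comment> \<open>The controlled value \<open>y'\<close> differs from \<open>y\<close> by an
      element of \<open>mul_rel A\<close>, to which \<open>y\<close> is orthogonal; hence
      \<open>y\<close> has no larger norm than \<open>y'\<close>.\<close>
    then have "norm y \<le> norm (y + (y' - y))" by (intro Y.norm_le_norm_add_orthogonal y)
    also have "\<dots> \<le> CA * norm x'" using y'(2) by simp
    also have "\<dots> \<le> CA * (CB * norm z)" using x'(2) CA(1) by (rule mult_left_mono)
    finally show ?thesis by (simp add: mult.assoc)
  qed
  have boundT: "norm y \<le> (CA * CB + CS) * norm z" if "(z, y) \<in> T" for z y
  proof -
    obtain z1 y1 z2 y2 where eq: "z = z1 + z2" "y = y1 + y2" and R: "(z1, y1) \<in> R" and S': "(z2, y2) \<in> S"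
      using \<open>(z, y) \<in> T\<close> unfolding T_def by blast
    \<comment> \<open>Orthogonality bounds the norms of both components \<open>z1\<close> and
      \<open>z2\<close> by that of \<open>z\<close>.\<close>
    have "ipZ z1 z2 = 0" using R S' S(3) unfolding R_def by blast
    note le = Z.norm_le_norm_add_orthogonal[OF this]
    have "norm y \<le> norm y1 + norm y2" unfolding eq by (rule norm_triangle_ineq)
    also have "\<dots> \<le> CA * CB * norm z1 + CS * norm z2" using boundR[OF R] CS(2)[OF S'] by simp
    also have "\<dots> \<le> CA * CB * norm z + CS * norm z"
      using le CA(1) CB(1) CS(1) unfolding eq by (intro add_mono mult_left_mono) auto
    finally show ?thesis by (simp add: distrib_right)
  qed
  have linR: "linear_relation sZ sY R"
    unfolding linear_relation_iff[OF ZY]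
  proof (intro conjI allI impI)
    have "ipZ 0 m = 0" "ipY 0 n = 0" for m n
      using Z.ip_diff_left[of 0 0 m] Y.ip_diff_left[of 0 0 n] by simp_all
    then show "(0, 0) \<in> R"
      using linA linB unfolding R_def linear_relation_iff[OF XY] linear_relation_iff[OF XZ] by blast
  next
    fix z y z' y' assume "(z, y) \<in> R" "(z', y') \<in> R"
    then show "(z + z', y + y') \<in> R"
      unfolding R_def using A_add B_add by (auto simp: Y.ip_add_left Z.ip_add_left) blast
  next
    fix c z y assume "(z, y) \<in> R"
    then show "(sZ c z, sY c y) \<in> R"
      using linA linB unfolding R_def linear_relation_iff[OF XY] linear_relation_iff[OF XZ]
      by (auto simp: Y.ip_scale_left Z.ip_scale_left) blast
  qed
  have linT: "linear_relation sZ sY T"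
    unfolding linear_relation_iff[OF ZY]
  proof (intro conjI allI impI)
    have "(0, 0) \<in> R" "(0, 0) \<in> S"
      using linR linS unfolding linear_relation_iff[OF ZY] by blast+
    then have "(0 + 0, 0 + 0) \<in> T" unfolding T_def by blast
    then show "(0, 0) \<in> T" by simp
  next
    fix z y z' y' assume "(z, y) \<in> T" "(z', y') \<in> T"
    then obtain z1 y1 z2 y2 z1' y1' z2' y2' where
      "z = z1 + z2" "y = y1 + y2" "(z1, y1) \<in> R" "(z2, y2) \<in> S"
      "z' = z1' + z2'" "y' = y1' + y2'" "(z1', y1') \<in> R" "(z2', y2') \<in> S"
      unfolding T_def by blast
    moreover from this have "(z1 + z1', y1 + y1') \<in> R" "(z2 + z2', y2 + y2') \<in> S"
      using linear_relation_add[OF ZY linR] linear_relation_add[OF ZY linS] by blast+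
    moreover have "z1 + z2 + (z1' + z2') = z1 + z1' + (z2 + z2')" "y1 + y2 + (y1' + y2') = y1 + y1' + (y2 + y2')"
      by simp_all
    ultimately show "(z + z', y + y') \<in> T" unfolding T_def by blast
  next
    fix c z y assume "(z, y) \<in> T"
    then obtain z1 y1 z2 y2 where
      "z = z1 + z2" "y = y1 + y2" "(z1, y1) \<in> R" "(z2, y2) \<in> S"
      unfolding T_def by blast
    moreover from this have "(sZ c z1, sY c y1) \<in> R" "(sZ c z2, sY c y2) \<in> S"
      using linR linS unfolding linear_relation_iff[OF ZY] by blast+
    moreover have "sZ c (z1 + z2) = sZ c z1 + sZ c z2" "sY c (y1 + y2) = sY c y1 + sY c y2"
      by (rule Z.scale_right_distrib, rule Y.scale_right_distrib)
    ultimately show "(sZ c z, sY c y) \<in> T" unfolding T_def by blast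
  qed
  have "mul_rel T = {0}"
    using boundT[of 0] linT unfolding linear_relation_iff[OF ZY] mul_rel_def by fastforce
  then have "bounded_operator_graph sZ sY T"
    using boundT linT unfolding bounded_operator_graph_def linear_operator_graph_def by blast
  \<comment> \<open>The \<open>S\<close>-part contributes \<open>(0, z2) \<in> B\<close> and
    \<open>(0, y2) \<in> A\<close>, so it can be removed from \<open>z\<close> and added back to the
    value under \<open>A\<close>.\<close>
  moreover have "(x, y) \<in> A" if xz: "(x, z) \<in> B" and zy: "(z, y) \<in> T" for x y z
  proof -
    obtain z1 y1 z2 y2 where eq: "z = z1 + z2" "y = y1 + y2" and R: "(z1, y1) \<in> R" and S': "(z2, y2) \<in> S"
      using zy unfolding T_def by blast
    obtain x1 where x1: "(x1, z1) \<in> B" "(x1, y1) \<in> A" using R unfolding R_def by blast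
    have mul: "(0, z2) \<in> B" "(0, y2) \<in> A" using S' S(3) by (auto simp: mul_rel_def)
    have "(x, z1) \<in> B" using B_diff[OF xz mul(1)] eq by simp
    then have "(x, y1) \<in> A" using transfer x1 by blast
    then show ?thesis using A_add[OF _ mul(2)] eq by fastforce
  qed
  moreover have "(x, y) \<in> B O T" if xy: "(x, y) \<in> A" for x y
  proof -
    obtain z where z: "(x, z) \<in> B" using dom xy by blast
    obtain m z1 where m: "z = z1 + m" "m \<in> mul_rel B" "\<And>n. n \<in> mul_rel B \<Longrightarrow> ipZ z1 n = 0"
      using Z.closed_subspace_decomposition[OF mulB B(3)] by blast
    obtain n y1 where n: "y = y1 + n" "n \<in> mul_rel A" "\<And>k. k \<in> mul_rel A \<Longrightarrow> ipY y1 k = 0"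
      using Y.closed_subspace_decomposition[OF mulA A(3)] by blast
    have z1: "(x, z1) \<in> B" using B_diff[OF z, of 0 m] m(1,2) by (simp add: mul_rel_def)
    have y1: "(x, y1) \<in> A" using A_diff[OF xy, of 0 n] n(1,2) by (simp add: mul_rel_def)
    have R: "(z1, y1) \<in> R" using z1 y1 m(3) n(3) unfolding R_def by blast
    \<comment> \<open>The component \<open>m\<close> of \<open>z\<close> is discarded and replaced
      by an \<open>S\<close>-preimage \<open>z2\<close> of \<open>n\<close>. As \<open>z2\<close> is
      also in \<open>mul_rel B\<close>, the vector \<open>z1 + z2\<close> is still a value of
      \<open>B\<close> at \<open>x\<close>, and \<open>T\<close> sends it to
      \<open>y1 + n = y\<close>.\<close>
    obtain z2 where z2: "(z2, n) \<in> S" using n(2) S(4) by blast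
    then have "(0, z2) \<in> B" using S(3) by (auto simp: mul_rel_def)
    then have "(x, z1 + z2) \<in> B" using B_add[OF z1] by fastforce
    moreover have "(z1 + z2, y) \<in> T" using R z2 n(1) unfolding T_def by blast
    ultimately show ?thesis by blast
  qed
  ultimately show ?thesis by (intro exI[of _ T]) auto
qed

theorem theorem2p8:
  fixes scaleX :: "'k::real_or_complex \<Rightarrow> 'x::banach \<Rightarrow> 'x" and ipX :: "'x \<Rightarrow> 'x \<Rightarrow> 'k"
    and scaleY :: "'k \<Rightarrow> 'y::banach \<Rightarrow> 'y" and ipY :: "'y \<Rightarrow> 'y \<Rightarrow> 'k"
    and scaleZ :: "'k \<Rightarrow> 'z::banach \<Rightarrow> 'z" and ipZ :: "'z \<Rightarrow> 'z \<Rightarrow> 'k"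
    and A :: "('x \<times> 'y) set" and B :: "('x \<times> 'z) set"
  assumes "hilbert_type scaleX ipX" and "separable_space (euclidean :: 'x topology)"
    and "hilbert_type scaleY ipY" and "separable_space (euclidean :: 'y topology)"
    and "hilbert_type scaleZ ipZ" and "separable_space (euclidean :: 'z topology)"
    and "range_space_relation scaleX scaleY A"
    and "range_space_relation scaleX scaleZ B"
    and "closed (Domain A)" and "closed (mul_rel A)"
    and "closed (Range B)" and "closed (ker_rel B)"
  shows "(\<exists>T :: ('z \<times> 'y) set. bounded_operator_graph scaleZ scaleY T \<and> A = B O T) \<longleftrightarrow>
    Domain A \<subseteq> Domain B \<and>
    ker_rel B \<subseteq> ker_rel A \<and>
    (\<exists>Tmul :: ('z \<times> 'y) set.
      range_space_operator scaleZ scaleY Tmul \<and>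
      Tmul \<subseteq> mul_rel B \<times> mul_rel A \<and>
      closedin (top_of_set (mul_rel B)) (Domain Tmul) \<and>
      Range Tmul = mul_rel A)"
proof -
  note X = assms(1) and Y = assms(3) and Z = assms(5) and A = assms(7) and B = assms(8)
  note XY = X[THEN hilbert_type_vector_space] Y[THEN hilbert_type_vector_space]
    and XZ = X[THEN hilbert_type_vector_space] Z[THEN hilbert_type_vector_space]
  have linA: "linear_relation scaleX scaleY A" and linB: "linear_relation scaleX scaleZ B"
    using A B by (simp_all add: range_space_relation_def)
  \<comment> \<open>Both directions rest on this: it keeps the closure of the restricted operator
    inside \<open>mul_rel B\<close>, and it permits orthogonal decomposition along
    \<open>mul_rel B\<close>.\<close>
  have mulB: "closed (mul_rel B)" by (rule closed_mul_rel[OF X Z B assms(11,12)])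
  show ?thesis
  proof (intro iffI; elim conjE exE)
    fix T :: "('z \<times> 'y) set" assume T: "bounded_operator_graph scaleZ scaleY T" and eq: "A = B O T"
    have "(0, 0) \<in> T"
      using T by (auto simp: bounded_operator_graph_def linear_operator_graph_def mul_rel_def)
    then have "Domain A \<subseteq> Domain B" "ker_rel B \<subseteq> ker_rel A" by (auto simp: eq ker_rel_def)
    then show "Domain A \<subseteq> Domain B \<and> ker_rel B \<subseteq> ker_rel A \<and>
      (\<exists>Tmul :: ('z \<times> 'y) set. range_space_operator scaleZ scaleY Tmul \<and> Tmul \<subseteq> mul_rel B \<times> mul_rel A \<and>
        closedin (top_of_set (mul_rel B)) (Domain Tmul) \<and> Range Tmul = mul_rel A)"
      using mul_operator_if_factor[OF Y Z mulB subspace_mul_rel[OF XZ linB] _ _ T]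
        assms(10) subspace_mul_rel[OF XY linA] by (simp add: eq)
  next
    fix Tmul :: "('z \<times> 'y) set"
    assume "Domain A \<subseteq> Domain B" "ker_rel B \<subseteq> ker_rel A" "range_space_operator scaleZ scaleY Tmul"
      and "closedin (top_of_set (mul_rel B)) (Domain Tmul)"
      and "Tmul \<subseteq> mul_rel B \<times> mul_rel A" "Range Tmul = mul_rel A"
    then show "\<exists>T. bounded_operator_graph scaleZ scaleY T \<and> A = B O T"
      \<comment> \<open>A domain that is closed relative to the closed set \<open>mul_rel B\<close>
        is closed in the whole space.\<close>
      using mulB closedin_closed_trans
      by (intro factor_if_mul_operator[OF X Y Z A assms(9,10) B assms(11) mulB, of Tmul]) auto
  qed
qed

end
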